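(* Let $\varepsilon > 0$ be fixed. For all real $x \geq 1$ and all integers $q \geq 1$ with $q \leq x$, we have $$\frac{1}{\varphi(q)} \sum_{\chi \neq \chi_0} \left| \sum_{1 \leq n \leq x} |\mu(n)| \chi(n) \right|^2 \ll x^{\varepsilon} \left( x^{1/2} q^{1/2} + \frac{x}{q^{1/2}} \right),$$ where the first sum is over all non-trivial Dirichlet characters $\chi$ modulo $q$ (that is, all Dirichlet characters modulo $q$ other than the trivial character $\chi_0$ modulo $q$).
   Context: Here $\mu$ is the Möbius function and $\varphi$ is Euler's totient function. The notation $A \ll B$ means that $|A| \leq C B$ for some constant $C > 0$ depending only on $\varepsilon$ (in particular, independent of $x$ and $q$). *)

theory Defs
  imports Complex_Main "HOL-Number_Theory.Number_Theory"
    "HOL-Computational_Algebra.Squarefree" "HOL-Library.FuncSet"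
begin

definition moebius_mu :: "nat \<Rightarrow> int" where
  "moebius_mu n = (if squarefree n then (-1) ^ card (prime_factors n) else 0)"

definition dirichlet_character :: "nat \<Rightarrow> (int \<Rightarrow> complex) \<Rightarrow> bool" where
  "dirichlet_character q \<chi> \<longleftrightarrow>
     (\<forall>a. \<chi> (a + int q) = \<chi> a) \<and>
     (\<forall>a b. \<chi> (a * b) = \<chi> a * \<chi> b) \<and>
     (\<forall>a. \<chi> a \<noteq> 0 \<longleftrightarrow> coprime a (int q))"

definition principal_character :: "nat \<Rightarrow> int \<Rightarrow> complex" where
  "principal_character q a = (if coprime a (int q) then 1 else 0)"

lemma dirichlet_character_principal: "dirichlet_character q (principal_character q)"
proof -
  have "coprime (a + int q) (int q) \<longleftrightarrow> coprime a (int q)" for a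
    by (simp only: coprime_iff_gcd_eq_1 gcd_add1)
  thus ?thesis
    unfolding dirichlet_character_def principal_character_def by simp
qed

text \<open>
  There are only finitely many Dirichlet characters to a given modulus, so sums over all of
  them are genuine sums rather than the default value for infinite index sets.
\<close>

lemma dirichlet_character_mod:
  assumes "dirichlet_character q \<chi>"
  shows "\<chi> (a mod int q) = \<chi> a"
proof -
  have *: "\<chi> (b + int q * int k) = \<chi> b" for b k
  proof (induction k)
    case (Suc k)
    have "\<chi> (b + int q * int (Suc k)) = \<chi> ((b + int q * int k) + int q)"
      by (simp add: algebra_simps)
    also have "\<dots> = \<chi> (b + int q * int k)"
      using assms unfolding dirichlet_character_def by blast
    finally show ?case using Suc.IH by simp
  qed simp
  show ?thesis
  proof (cases "a div int q \<ge> 0")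
    case True
    with *[of "a mod int q" "nat (a div int q)"] show ?thesis by simp
  next
    case False
    have "a + int q * int (nat (- (a div int q))) = a mod int q"
      using False by (simp add: minus_mult_div_eq_mod)
    with *[of a "nat (- (a div int q))"] show ?thesis by simp
  qed
qed

lemma dirichlet_character_root_of_unity:
  assumes \<chi>: "dirichlet_character q \<chi>" and "coprime a (int q)"
  shows "\<chi> a ^ totient q = 1"
proof -
  have one: "\<chi> 1 = 1"
  proof -
    have "\<chi> (1 * 1) = \<chi> 1 * \<chi> 1"
      using \<chi> unfolding dirichlet_character_def by blast
    moreover have "coprime 1 (int q)" by simp
    hence "\<chi> 1 \<noteq> 0" using \<chi> unfolding dirichlet_character_def by blast
    ultimately show ?thesis by simp
  qed
  have pow: "\<chi> (a ^ k) = \<chi> a ^ k" for k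
  proof (induction k)
    case (Suc k)
    have "\<chi> (a * a ^ k) = \<chi> a * \<chi> (a ^ k)"
      using \<chi> unfolding dirichlet_character_def by blast
    thus ?case using Suc.IH by simp
  qed (simp add: one)
  show ?thesis
  proof (cases "q = 0")
    case False
    have "[a ^ totient q = 1] (mod int q)"
    proof -
      define b where "b = nat (a mod int q)"
      have b: "int b = a mod int q" using False by (simp add: b_def)
      have "coprime (int b) (int q)"
        using assms(2) False unfolding b by simp
      hence "[b ^ totient q = 1] (mod q)" by (intro euler_theorem) simp
      hence "[int b ^ totient q = 1] (mod int q)"
        by (metis cong_int_iff of_nat_1 of_nat_power)
      moreover have "[a = int b] (mod int q)" by (simp add: b cong_def)
      ultimately show ?thesis using cong_pow cong_trans by blast
    qed
    hence "\<chi> (a ^ totient q) = \<chi> 1"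
      using dirichlet_character_mod[OF \<chi>] unfolding cong_def by metis
    thus ?thesis using one pow by simp
  qed simp
qed

lemma finite_dirichlet_characters:
  assumes "q \<ge> 1"
  shows "finite {\<chi>. dirichlet_character q \<chi>}"
proof -
  define R where "R = insert 0 {z::complex. z ^ totient q = 1}"
  have "finite R"
    using assms finite_roots_unity[of "totient q"] by (simp add: R_def Suc_leI)
  hence fin: "finite ({0..<int q} \<rightarrow>\<^sub>E R)" by (intro finite_PiE) auto
  have "inj_on (\<lambda>\<chi>. restrict \<chi> {0..<int q}) {\<chi>. dirichlet_character q \<chi>}"
  proof (rule inj_onI, rule ext)
    fix \<chi> \<psi> a
    assume chars: "\<chi> \<in> {\<chi>. dirichlet_character q \<chi>}" "\<psi> \<in> {\<chi>. dirichlet_character q \<chi>}"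
      and eq: "restrict \<chi> {0..<int q} = restrict \<psi> {0..<int q}"
    have "a mod int q \<in> {0..<int q}" using assms by simp
    hence "\<chi> (a mod int q) = \<psi> (a mod int q)" using fun_cong[OF eq] by (metis restrict_apply')
    thus "\<chi> a = \<psi> a"
      using chars dirichlet_character_mod[of q \<chi> a] dirichlet_character_mod[of q \<psi> a] by simp
  qed
  moreover have "(\<lambda>\<chi>. restrict \<chi> {0..<int q}) ` {\<chi>. dirichlet_character q \<chi>}
      \<subseteq> {0..<int q} \<rightarrow>\<^sub>E R"
  proof clarify
    fix \<chi> assume \<chi>: "dirichlet_character q \<chi>"
    have "\<chi> a \<in> R" for a
    proof (cases "coprime a (int q)")
      case True
      thus ?thesis using dirichlet_character_root_of_unity[OF \<chi>] by (simp add: R_def)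
    next
      case False
      hence "\<chi> a = 0" using \<chi> unfolding dirichlet_character_def by blast
      thus ?thesis by (simp add: R_def)
    qed
    thus "restrict \<chi> {0..<int q} \<in> {0..<int q} \<rightarrow>\<^sub>E R" by simp
  qed
  ultimately show ?thesis using fin by (metis inj_on_finite)
qed

end

theory Submission
  imports Defs "HOL-Analysis.Convex"
begin

text \<open>
  Since \<open>\<bar>\<mu>(n)\<bar>\<close> is the sum of \<open>\<mu>(d)\<close> over \<open>d\<^sup>2\<close> dividing \<open>n\<close>, the character sum is the sum over \<open>d\<close> of
  \<open>\<mu>(d) \<chi>(d\<^sup>2) S(x / d\<^sup>2)\<close> with \<open>S(y)\<close> the sum of \<open>\<chi>(m)\<close> over \<open>m \<le> y\<close>. Split \<open>d\<close> into dyadic blocks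
  \<open>K \<le> d < 2K\<close> and put \<open>M = x / K\<^sup>2\<close>. By Bessel's inequality a block contributes at most the number of
  solutions of \<open>d\<^sub>1\<^sup>2 m\<^sub>1 \<equiv> d\<^sub>2\<^sup>2 m\<^sub>2\<close> modulo \<open>q\<close>, which by Cauchy--Schwarz is at most the geometric mean of the
  numbers of solutions of \<open>(d\<^sub>1 d\<^sub>2)\<^sup>2 \<equiv> (d\<^sub>3 d\<^sub>4)\<^sup>2\<close> and \<open>m\<^sub>1 m\<^sub>2 \<equiv> m\<^sub>3 m\<^sub>4\<close>. The divisor bound makes these
  \<open>K\<^sup>2 + K\<^sup>4 / q\<close> and \<open>M\<^sup>2 + M\<^sup>4 / q\<close> up to \<open>x\<^sup>\<epsilon>\<close>, which suffices if \<open>M\<^sup>2 \<le> q\<close>. Otherwise expand \<open>S\<close> in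
  additive characters modulo \<open>q\<close>: the zero frequency vanishes for a non-principal \<open>\<chi>\<close>, and a
  frequency \<open>h = g u\<close> with \<open>g = gcd h q\<close> has a Gauss sum of size at most \<open>sqrt (q g)\<close> that depends on \<open>u\<close> only
  through a factor \<open>\<chi>(w)\<close>, \<open>w\<close> an inverse of \<open>u\<close> modulo \<open>q / g\<close>; so the same counting applies to the
  dual variable \<open>u\<close>, of length about \<open>q / (g M)\<close>. In both cases a block contributes at most
  \<open>min M q \<cdot> (K + K\<^sup>2 / sqrt q)\<close> up to \<open>x\<^sup>\<epsilon>\<close>, and \<open>M K\<^sup>2 = x\<close> gives the claim.
\<close>

section \<open>Divisors and the Moebius function\<close>

lemma card_divisors_prime_power_mult_le:
  fixes p m :: nat
  assumes "prime p" "m > 0" "\<not> p dvd m"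
  shows "card {d. d dvd p ^ a * m} \<le> (a + 1) * card {d. d dvd m}"
proof -
  have "{d. d dvd p ^ a * m} \<subseteq> (\<lambda>(i, e). p ^ i * e) ` ({..a} \<times> {d. d dvd m})"
  proof
    fix d assume "d \<in> {d. d dvd p ^ a * m}"
    then obtain b c where bc: "d = b * c" "b dvd p ^ a" "c dvd m"
      by (auto elim: dvd_productE)
    then obtain i where "i \<le> a" "b = p ^ i"
      using divides_primepow_nat[OF assms(1)] by auto
    then show "d \<in> (\<lambda>(i, e). p ^ i * e) ` ({..a} \<times> {d. d dvd m})"
      using bc by auto
  qed
  moreover have "finite {d. d dvd m}" using assms(2) by simp
  ultimately have "card {d. d dvd p ^ a * m} \<le> card ({..a} \<times> {d. d dvd m})"
    by (meson finite_SigmaI finite_atMost surj_card_le)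
  then show ?thesis by (simp add: card_cartesian_product)
qed

text \<open>The power is at least 1 + a \<epsilon> ln p >= 1 + a \<epsilon> / 2, as ln 2 >= 1/2, and
  the factor 1 + 2 / \<epsilon> lifts this above a + 1. In the divisor bound each small prime costs
  this factor once.\<close>

lemma real_Suc_le_powr:
  assumes "\<epsilon> > 0" "p \<ge> (2::real)"
  shows "real a + 1 \<le> (1 + 2 / \<epsilon>) * (p powr (real a * \<epsilon>))"
proof -
  have "real a * \<epsilon> * ln 2 \<le> real a * \<epsilon> * ln p"
    using assms by (intro mult_left_mono) auto
  moreover have "1 / 2 \<le> ln (2::real)"
    using ln_one_minus_pos_upper_bound[of "1/2"] by (simp add: ln_div)
  ultimately have "real a * \<epsilon> * (1/2) \<le> real a * \<epsilon> * ln p"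
    using assms mult_left_mono[of "1/2" "ln 2" "real a * \<epsilon>"] by simp
  then have "1 + real a * \<epsilon> / 2 \<le> exp (real a * \<epsilon> * ln p)"
    using exp_ge_add_one_self[of "real a * \<epsilon> * ln p"] by linarith
  then have *: "1 + real a * \<epsilon> / 2 \<le> p powr (real a * \<epsilon>)"
    using assms by (simp add: powr_def)
  have "real a + 1 \<le> (1 + 2 / \<epsilon>) * (1 + real a * \<epsilon> / 2)"
    using assms by (simp add: field_simps)
  also have "\<dots> \<le> (1 + 2 / \<epsilon>) * (p powr (real a * \<epsilon>))"
    using * assms by (intro mult_left_mono) auto
  finally show ?thesis .
qed

text \<open>Here p powr \<epsilon> is at least 2, so the power is at least 2^a >= a + 1: large
  primes cost no constant.\<close>

lemma real_Suc_le_powr_large: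
  assumes "\<epsilon> > 0" "p \<ge> 2 powr (1 / \<epsilon>)"
  shows "real a + 1 \<le> p powr (real a * \<epsilon>)"
proof -
  have "real a + 1 \<le> 2 ^ a"
    by (metis add.commute of_nat_Suc of_nat_le_iff of_nat_numeral of_nat_power Suc_leI less_exp)
  also have "\<dots> = (2 powr (1/\<epsilon>)) powr (real a * \<epsilon>)"
    using assms by (simp add: powr_powr powr_realpow)
  also have "\<dots> \<le> p powr (real a * \<epsilon>)"
    using assms by (intro powr_mono2) auto
  finally show ?thesis .
qed

text \<open>The divisor count is at most the product of a + 1 over the prime powers p^a exactly
  dividing n. Each factor is compared with p powr (a \<epsilon>); only primes below \<open>P\<close>
  cost a factor \<open>K\<close>, and their number is bounded independently of n.\<close>

lemma divisor_bound:
  fixes \<epsilon> :: real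
  assumes "\<epsilon> > 0"
  obtains C where "C \<ge> 1" "\<And>n::nat. n > 0 \<Longrightarrow> real (card {d. d dvd n}) \<le> C * real n powr \<epsilon>"
proof -
  define P where "P = 2 powr (1 / \<epsilon>)"
  define K where "K = 1 + 2 / \<epsilon>"
  have K: "K \<ge> 1" using assms by (simp add: K_def)
  define S where "S n = {p. prime p \<and> p dvd n \<and> real p < P}" for n :: nat
  have finS: "finite {p::nat. real p < P}"
    by (rule finite_subset[of _ "{..nat \<lceil>P\<rceil>}"]) (auto, linarith)
  have fin: "finite (S n)" for n
    by (rule finite_subset[OF _ finS]) (auto simp: S_def)
  \<comment> \<open>The induction strips off the full power of one prime p. The exponent of
    \<open>K\<close> counts the small primes dividing n, so it grows by one exactly when p <
    P.\<close>
  have main: "real (card {d. d dvd n}) \<le> K ^ card (S n) * real n powr \<epsilon>" if "n > 0" for n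
    using that
  proof (induction n rule: less_induct)
    case (less n)
    show ?case
    proof (cases "n = 1")
      case True
      then show ?thesis using K by (simp add: one_le_power)
    next
      case False
      then obtain p where p: "prime p" "p dvd n" using prime_factor_nat by blast
      obtain m where m: "n = p ^ multiplicity p n * m" "\<not> p dvd m"
        using multiplicity_decompose'[of n p] less.prems p by (metis not_prime_unit bot_nat_0.not_eq_extremum)
      define a where "a = multiplicity p n"
      have m0: "m > 0" using m less.prems by (cases m) auto
      have a: "a > 0" using p less.prems by (simp add: a_def prime_multiplicity_gt_zero_iff)
      have mn: "m < n"
      proof -
        have "1 < p ^ a" using a prime_gt_1_nat[OF p(1)] one_less_power by blast
        then have "1 * m < p ^ a * m" using m0 by (intro mult_strict_right_mono) auto
        then show ?thesis using m(1) by (simp add: a_def)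
      qed
      have S: "S n = (if real p < P then insert p (S m) else S m)"
      proof -
        have "r dvd n \<longleftrightarrow> r = p \<or> r dvd m" if "prime r" for r
          using that p a m(1) primes_dvd_imp_eq[of r p]
          by (metis a_def dvd_mult dvd_refl prime_dvd_mult_iff prime_dvd_power_iff)
        then show ?thesis using p(1) unfolding S_def by auto
      qed
      have pS: "p \<notin> S m" using m by (auto simp: S_def)
      have f: "real a + 1 \<le> (if real p < P then K else 1) * (real p powr (real a * \<epsilon>))"
        using real_Suc_le_powr[OF assms, of "real p" a] real_Suc_le_powr_large[OF assms, of "real p" a]
          prime_ge_2_nat[OF p(1)] by (auto simp: K_def P_def)
      have "card {d. d dvd n} \<le> (a + 1) * card {d. d dvd m}"
        using card_divisors_prime_power_mult_le[OF p(1) m0 m(2), of a] m(1) by (simp add: a_def)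
      then have "real (card {d. d dvd n}) \<le> real (a + 1) * real (card {d. d dvd m})"
        by (simp only: of_nat_mult [symmetric] of_nat_le_iff)
      also have "\<dots> \<le> ((if real p < P then K else 1) * (real p powr (real a * \<epsilon>))) * (K ^ card (S m) * real m powr \<epsilon>)"
        using f less.IH[OF mn m0] K by (intro mult_mono) (auto simp: add.commute)
      also have "\<dots> = K ^ card (S n) * (real p powr (real a * \<epsilon>) * real m powr \<epsilon>)"
        using S pS fin[of m] by simp
      also have "real p powr (real a * \<epsilon>) * real m powr \<epsilon> = real n powr \<epsilon>"
      proof -
        have "real n = real p powr real a * real m"
          using arg_cong[OF m(1), of real] prime_gt_0_nat[OF p(1)]
          by (simp add: a_def powr_realpow del: of_nat_eq_iff)
        then show ?thesis by (simp add: powr_mult powr_powr)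
      qed
      finally show ?thesis .
    qed
  qed
  show ?thesis
  proof (rule that)
    \<comment> \<open>All natural numbers below \<open>P\<close> are counted, a crude but uniform
      bound for the number of small primes.\<close>
    show "1 \<le> K ^ card {p::nat. real p < P}" using K by (simp add: one_le_power)
    fix n :: nat assume n: "n > 0"
    have "card (S n) \<le> card {p::nat. real p < P}"
      by (rule card_mono[OF finS]) (auto simp: S_def)
    then have "K ^ card (S n) \<le> K ^ card {p::nat. real p < P}"
      using K by (rule power_increasing)
    then show "real (card {d. d dvd n}) \<le> K ^ card {p::nat. real p < P} * real n powr \<epsilon>"
      using main[OF n] by (meson mult_right_mono order_trans powr_ge_zero)
  qed
qed

text \<open>Only squarefree divisors contribute. Taking products, they correspond to the subsets of
  the prime factors of n, and the alternating sum over all subsets of a nonempty finite set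
  vanishes.\<close>

lemma sum_moebius_divisors:
  fixes n :: nat
  assumes "n > 0"
  shows "(\<Sum>d | d dvd n. moebius_mu d) = (if n = 1 then 1 else 0)"
proof -
  have fin: "finite {d. d dvd n}" using assms by simp
  have bij: "bij_betw (\<lambda>A. \<Prod>A) (Pow (prime_factors n)) {d. d dvd n \<and> squarefree d}"
  proof (rule bij_betwI[where g = prime_factors])
    have P: "squarefree (\<Prod>A)" "prime_factors (\<Prod>A) = A" "\<Prod>A dvd n" if "A \<subseteq> prime_factors n" for A
    proof -
      have finA: "finite A" using that finite_subset by blast
      have pr: "\<And>p. p \<in> A \<Longrightarrow> prime p" using that by auto
      have "prime_factorization (\<Prod>A) = mset_set A"
        using prime_factorization_prod_mset_primes[of "mset_set A"] finA pr
        by (simp add: prod_unfold_prod_mset)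
      then show "prime_factors (\<Prod>A) = A" using finA by simp
      show "squarefree (\<Prod>A)"
        using finA pr by (intro squarefree_prod_coprime) (auto simp: primes_coprime squarefree_prime)
      have "prime_factorization (\<Prod>A) \<subseteq># prime_factorization n"
        using \<open>prime_factorization (\<Prod>A) = mset_set A\<close> that
        by (metis finite_set_mset mset_set_set_mset_msubset msubset_mset_set_iff finA subset_mset.order_trans)
      moreover have "\<Prod>A \<noteq> 0" using finA pr by (metis not_prime_0 prod_zero_iff)
      ultimately show "\<Prod>A dvd n" using assms by (simp add: prime_factorization_subset_iff_dvd)
    qed
    show "(\<lambda>A. \<Prod>A) \<in> Pow (prime_factors n) \<rightarrow> {d. d dvd n \<and> squarefree d}" using P by auto
    show "prime_factors \<in> {d. d dvd n \<and> squarefree d} \<rightarrow> Pow (prime_factors n)"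
      using assms by (auto simp: dvd_prime_factors)
    show "\<And>x. x \<in> Pow (prime_factors n) \<Longrightarrow> prime_factors (\<Prod>x) = x" using P by auto
    fix y assume y: "y \<in> {d. d dvd n \<and> squarefree d}"
    then have "y \<noteq> 0" using assms by auto
    have "y = (\<Prod>p\<in>prime_factors y. p ^ multiplicity p y)"
      using \<open>y \<noteq> 0\<close> prime_factorization_nat by blast
    also have "\<dots> = \<Prod>(prime_factors y)"
    proof (intro prod.cong refl)
      fix p assume "p \<in> prime_factors y"
      then have "multiplicity p y > 0" "prime p" by (auto simp: prime_factors_multiplicity)
      moreover have "multiplicity p y \<le> 1"
        using y squarefree_factorial_semiring''[of y] \<open>y \<noteq> 0\<close> \<open>prime p\<close> by auto
      ultimately have "multiplicity p y = 1" by linarith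
      then show "p ^ multiplicity p y = p" by simp
    qed
    finally show "\<Prod>(prime_factors y) = y" by simp
  qed
  have "(\<Sum>d | d dvd n. moebius_mu d) = (\<Sum>d | d dvd n \<and> squarefree d. (-1) ^ card (prime_factors d))"
    using fin by (intro sum.mono_neutral_cong_right) (auto simp: moebius_mu_def)
  also have "\<dots> = (\<Sum>A\<in>Pow (prime_factors n). (-1) ^ card (prime_factors (\<Prod>A)))"
    by (rule sum.reindex_bij_betw[OF bij, symmetric])
  also have "\<dots> = (\<Sum>A\<in>Pow (prime_factors n). (-1) ^ card A)"
  proof (intro sum.cong refl)
    fix A assume A: "A \<in> Pow (prime_factors n)"
    have "prime_factorization (\<Prod>A) = mset_set A"
      using prime_factorization_prod_mset_primes[of "mset_set A"] A finite_subset[of A]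
      by (auto simp: prod_unfold_prod_mset)
    then show "(-1) ^ card (prime_factors (\<Prod>A)) = ((-1) ^ card A :: int)" using A finite_subset[of A] by simp
  qed
  also have "\<dots> = (if prime_factors n = {} then 1 else 0)"
  proof (cases "prime_factors n = {}")
    case False
    have "(\<Sum>A\<in>Pow (prime_factors n). (-1) ^ card A) = (0::int)"
      using False card_subsupersets_even_odd[of "prime_factors n" "{}"]
      by (intro sum_alternating_cancels) (auto simp: psubset_eq)
    with False show ?thesis by simp
  qed simp
  also have "prime_factors n = {} \<longleftrightarrow> n = 1" using assms
    by (auto simp: prime_factorization_empty_iff)
  finally show ?thesis .
qed

text \<open>A square d^2 divides n iff d divides \<open>square_part n\<close>, so this is the full
  divisor sum for \<open>square_part n\<close>, which is 1 exactly for squarefree n.\<close>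

lemma abs_moebius_eq_sum:
  fixes n :: nat
  assumes "n > 0"
  shows "\<bar>moebius_mu n\<bar> = (\<Sum>d | d\<^sup>2 dvd n. moebius_mu d)"
proof -
  have "square_part n > 0" using assms by (metis square_part_0_iff gr0I)
  moreover have "square_part n = 1 \<longleftrightarrow> squarefree n"
    using dvd_square_part_iff[of _ n] unfolding squarefree_def
    by (metis dvd_refl nat_dvd_1_iff_1)
  ultimately show ?thesis
    using sum_moebius_divisors[of "square_part n"]
    by (simp add: dvd_square_part_iff moebius_mu_def)
qed

text \<open>Interchanging the sums and writing n = d^2 m replaces the squarefree n by all m in an
  interval, where character sums can be estimated.\<close>

lemma sum_abs_moebius_eq:
  fixes f :: "nat \<Rightarrow> complex"
  shows "(\<Sum>n=1..N. of_int \<bar>moebius_mu n\<bar> * f n)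
       = (\<Sum>d | 1 \<le> d \<and> d\<^sup>2 \<le> N. of_int (moebius_mu d) * (\<Sum>m=1..N div d\<^sup>2. f (d\<^sup>2 * m)))"
proof -
  have "(\<Sum>n=1..N. of_int \<bar>moebius_mu n\<bar> * f n)
      = (\<Sum>n=1..N. \<Sum>d\<in>{d. 1 \<le> d \<and> d\<^sup>2 \<le> N} \<inter> {d. d\<^sup>2 dvd n}. of_int (moebius_mu d) * f n)"
  proof (intro sum.cong refl)
    fix n assume n: "n \<in> {1..N}"
    have "{d. d\<^sup>2 dvd n} = {d. 1 \<le> d \<and> d\<^sup>2 \<le> N} \<inter> {d. d\<^sup>2 dvd n}"
    proof -
      have "1 \<le> d \<and> d\<^sup>2 \<le> N" if "d\<^sup>2 dvd n" for d
        using that n dvd_imp_le[OF that] by (cases "d = 0") auto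
      then show ?thesis by auto
    qed
    then show "of_int \<bar>moebius_mu n\<bar> * f n
      = (\<Sum>d\<in>{d. 1 \<le> d \<and> d\<^sup>2 \<le> N} \<inter> {d. d\<^sup>2 dvd n}. of_int (moebius_mu d) * f n)"
      using abs_moebius_eq_sum[of n] n by (simp add: sum_distrib_right)
  qed
  also have "\<dots> = (\<Sum>d | 1 \<le> d \<and> d\<^sup>2 \<le> N. \<Sum>n\<in>{1..N} \<inter> {n. d\<^sup>2 dvd n}. of_int (moebius_mu d) * f n)"
  proof -
    have "finite {d. 1 \<le> d \<and> d\<^sup>2 \<le> N}"
      by (rule finite_subset[of _ "{..N}"]) (auto intro: order_trans[OF power2_nat_le_imp_le])
    then show ?thesis
      using sum.swap_restrict[of "{1..N}" "{d. 1 \<le> d \<and> d\<^sup>2 \<le> N}" "\<lambda>n d. of_int (moebius_mu d) * f n" "\<lambda>n d. d\<^sup>2 dvd n"]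
      by (simp add: Int_def)
  qed
  also have "\<dots> = (\<Sum>d | 1 \<le> d \<and> d\<^sup>2 \<le> N. of_int (moebius_mu d) * (\<Sum>m=1..N div d\<^sup>2. f (d\<^sup>2 * m)))"
  proof (intro sum.cong refl)
    fix d assume d: "d \<in> {d. 1 \<le> d \<and> d\<^sup>2 \<le> N}"
    then have d0: "d\<^sup>2 > 0" by simp
    have "bij_betw (\<lambda>m. d\<^sup>2 * m) {1..N div d\<^sup>2} ({1..N} \<inter> {n. d\<^sup>2 dvd n})"
      using d0 by (intro bij_betwI[where g = "\<lambda>n. n div d\<^sup>2"])
        (auto simp: less_eq_div_iff_mult_less_eq mult.commute div_le_mono elim!: dvdE)
    from sum.reindex_bij_betw[OF this, of f]
    show "(\<Sum>n\<in>{1..N} \<inter> {n. d\<^sup>2 dvd n}. of_int (moebius_mu d) * f n)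
        = of_int (moebius_mu d) * (\<Sum>m=1..N div d\<^sup>2. f (d\<^sup>2 * m))"
      by (simp add: sum_distrib_left)
  qed
  finally show ?thesis .
qed

section \<open>Orthogonality of Dirichlet characters\<close>

lemma dirichlet_character_mult: "dirichlet_character q \<chi> \<Longrightarrow> \<chi> (a * b) = \<chi> a * \<chi> b"
  by (simp add: dirichlet_character_def)

lemma dirichlet_character_eq_0_iff: "dirichlet_character q \<chi> \<Longrightarrow> \<chi> a = 0 \<longleftrightarrow> \<not> coprime a (int q)"
  by (auto simp: dirichlet_character_def)

lemma norm_dirichlet_character:
  assumes "dirichlet_character q \<chi>" "q \<ge> 1" "coprime a (int q)"
  shows "cmod (\<chi> a) = 1"
proof -
  have "cmod (\<chi> a) ^ totient q = 1"
    using dirichlet_character_root_of_unity[OF assms(1,3)] by (metis norm_one norm_power)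
  then show ?thesis using assms(2)
    by (metis norm_ge_zero power_eq_imp_eq_base power_one totient_gt_0_iff zero_less_one_class.zero_le_one
        less_le_trans zero_less_one)
qed

text \<open>Reduction by \<open>mod\<close> lands in [0, q), hence these representatives of the unit
  group in place of \<open>totatives\<close>. For positive q the two sets differ only at q = 1,
  where 0 replaces 1.\<close>

definition residues_coprime :: "nat \<Rightarrow> int set" where
  "residues_coprime q = {a \<in> {0..<int q}. coprime a (int q)}"

lemma finite_residues_coprime [simp]: "finite (residues_coprime q)"
  by (rule finite_subset[of _ "{0..<int q}"]) (auto simp: residues_coprime_def)

lemma card_residues_coprime:
  assumes "q \<ge> 1"
  shows "card (residues_coprime q) = totient q"
proof (cases "q = 1")
  case True
  have "residues_coprime 1 = {0}" by (auto simp: residues_coprime_def)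
  then show ?thesis using True by simp
next
  case False
  then have q: "q > 1" using assms by simp
  have "bij_betw int (totatives q) (residues_coprime q)"
  proof (rule bij_betwI[where g = nat])
    show "int \<in> totatives q \<rightarrow> residues_coprime q"
      using q totatives_less[OF _ q] by (auto simp: residues_coprime_def in_totatives_iff)
    show "nat \<in> residues_coprime q \<rightarrow> totatives q"
    proof
      fix a assume a: "a \<in> residues_coprime q"
      then have "a \<noteq> 0" using q by (auto simp: residues_coprime_def)
      then have "a > 0" using a by (auto simp: residues_coprime_def)
      then have "coprime (int (nat a)) (int q)" using a by (simp add: residues_coprime_def)
      then show "nat a \<in> totatives q" using a \<open>a > 0\<close>
        by (auto simp: residues_coprime_def in_totatives_iff simp flip: coprime_int_iff)
    qed
  qed (auto simp: residues_coprime_def)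
  from bij_betw_same_card[OF this] show ?thesis by (simp add: totient_def)
qed

lemma bij_betw_mult_residues_coprime:
  assumes "q \<ge> 1" "coprime b (int q)"
  shows "bij_betw (\<lambda>a. (b * a) mod int q) (residues_coprime q) (residues_coprime q)"
proof -
  have "inj_on (\<lambda>a. (b * a) mod int q) (residues_coprime q)"
  proof (rule inj_onI)
    fix x y assume xy: "x \<in> residues_coprime q" "y \<in> residues_coprime q"
      "(b * x) mod int q = (b * y) mod int q"
    then have "[x = y] (mod int q)"
      using cong_mult_lcancel[OF assms(2)] unfolding cong_def by blast
    then show "x = y" using xy(1,2) by (simp add: cong_def residues_coprime_def)
  qed
  moreover have "(\<lambda>a. (b * a) mod int q) ` residues_coprime q \<subseteq> residues_coprime q"
    using assms by (auto simp: residues_coprime_def)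
  ultimately show ?thesis
    by (simp add: bij_betw_def endo_inj_surj)
qed

lemma sum_residues_coprime_mult:
  assumes "q \<ge> 1" "coprime b (int q)" "\<And>a. f (a mod int q) = f a"
  shows "(\<Sum>a\<in>residues_coprime q. f (b * a)) = (\<Sum>a\<in>residues_coprime q. f a)"
  using sum.reindex_bij_betw[OF bij_betw_mult_residues_coprime[OF assms(1,2)], of f] assms(3)
  by simp

text \<open>A point b where the characters differ is a unit, since both vanish elsewhere.
  Substituting b a for a multiplies the sum by \<open>\<chi> b * cnj (\<psi> b)\<close>, which is
  not 1.\<close>

lemma sum_dirichlet_character_mult_cnj_eq_0:
  assumes \<chi>: "dirichlet_character q \<chi>" and \<psi>: "dirichlet_character q \<psi>" and "\<chi> \<noteq> \<psi>" and q: "q \<ge> 1"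
  shows "(\<Sum>a\<in>residues_coprime q. \<chi> a * cnj (\<psi> a)) = 0"
proof -
  obtain b where b: "\<chi> b \<noteq> \<psi> b" using \<open>\<chi> \<noteq> \<psi>\<close> by auto
  then have cb: "coprime b (int q)"
    using dirichlet_character_eq_0_iff[OF \<chi>, of b] dirichlet_character_eq_0_iff[OF \<psi>, of b] by metis
  have "cnj (\<psi> b) * \<psi> b = 1"
    using norm_dirichlet_character[OF \<psi> q cb] by (simp add: complex_norm_square[symmetric] mult.commute)
  then have "\<chi> b * cnj (\<psi> b) \<noteq> 1"
    using b by (metis mult.assoc mult.commute mult.right_neutral)
  moreover have "(\<Sum>a\<in>residues_coprime q. \<chi> a * cnj (\<psi> a))
      = (\<Sum>a\<in>residues_coprime q. \<chi> (b * a) * cnj (\<psi> (b * a)))"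
    by (rule sum_residues_coprime_mult[OF q cb, symmetric])
      (simp add: dirichlet_character_mod[OF \<chi>] dirichlet_character_mod[OF \<psi>])
  moreover have "(\<Sum>a\<in>residues_coprime q. \<chi> (b * a) * cnj (\<psi> (b * a)))
      = \<chi> b * cnj (\<psi> b) * (\<Sum>a\<in>residues_coprime q. \<chi> a * cnj (\<psi> a))"
    by (simp add: dirichlet_character_mult[OF \<chi>] dirichlet_character_mult[OF \<psi>] sum_distrib_left mult_ac)
  ultimately show ?thesis by (metis mult_cancel_right1 mult_1)
qed

lemma sum_dirichlet_character_mult_cnj_self:
  assumes \<chi>: "dirichlet_character q \<chi>" and q: "q \<ge> 1"
  shows "(\<Sum>a\<in>residues_coprime q. \<chi> a * cnj (\<chi> a)) = of_nat (totient q)"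
proof -
  have "\<chi> a * cnj (\<chi> a) = 1" if "a \<in> residues_coprime q" for a
    using norm_dirichlet_character[OF \<chi> q, of a] that
    by (simp add: residues_coprime_def complex_norm_square[symmetric])
  then show ?thesis by (simp add: card_residues_coprime[OF q])
qed

text \<open>The characters are orthogonal on the units with squared norm \<open>totient q\<close>,
  so \<open>h\<close> below is the orthogonal projection of \<open>f\<close> to the span of the
  conjugates of the members of \<open>X\<close>. The inequality is the nonnegativity of the squared
  norm of \<open>f - h\<close>.\<close>

lemma bessel_dirichlet_characters:
  fixes f :: "int \<Rightarrow> complex"
  assumes q: "q \<ge> 1" and X: "X \<subseteq> {\<chi>. dirichlet_character q \<chi>}"
  shows "(\<Sum>\<chi>\<in>X. (cmod (\<Sum>a\<in>residues_coprime q. f a * \<chi> a))\<^sup>2)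
      \<le> real (totient q) * (\<Sum>a\<in>residues_coprime q. (cmod (f a))\<^sup>2)"
proof -
  let ?G = "residues_coprime q"
  define Y where "Y \<chi> = (\<Sum>a\<in>?G. f a * \<chi> a)" for \<chi> :: "int \<Rightarrow> complex"
  define \<phi> where "\<phi> = (of_nat (totient q) :: complex)"
  have \<phi>: "\<phi> \<noteq> 0" using q by (simp add: \<phi>_def)
  have finX: "finite X" using finite_dirichlet_characters[OF q] X by (rule rev_finite_subset)
  define E where "E = (\<Sum>\<chi>\<in>X. Y \<chi> * cnj (Y \<chi>))"
  define h where "h a = (\<Sum>\<chi>\<in>X. Y \<chi> * cnj (\<chi> a)) / \<phi>" for a
  have cnj_h: "cnj (h a) = (\<Sum>\<chi>\<in>X. cnj (Y \<chi>) * \<chi> a) / \<phi>" for a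
    by (simp add: h_def \<phi>_def)
  \<comment> \<open>The inner product of \<open>f\<close> with \<open>h\<close> and the squared norm
    of \<open>h\<close> both come out as \<open>E / \<phi>\<close>, a real number, so the squared
    norm of \<open>f - h\<close> is that of \<open>f\<close> minus
    \<open>E / \<phi>\<close>.\<close>
  have cross: "(\<Sum>a\<in>?G. f a * cnj (h a)) = E / \<phi>"
  proof -
    have "(\<Sum>a\<in>?G. f a * cnj (h a)) = (\<Sum>a\<in>?G. \<Sum>\<chi>\<in>X. f a * (cnj (Y \<chi>) * \<chi> a)) / \<phi>"
      unfolding cnj_h sum_divide_distrib[of _ ?G] by (simp only: sum_distrib_left times_divide_eq_right)
    also have "\<dots> = (\<Sum>\<chi>\<in>X. \<Sum>a\<in>?G. f a * (cnj (Y \<chi>) * \<chi> a)) / \<phi>"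
      by (subst sum.swap) simp
    also have "(\<Sum>\<chi>\<in>X. \<Sum>a\<in>?G. f a * (cnj (Y \<chi>) * \<chi> a)) = E"
      unfolding E_def
    proof (intro sum.cong refl)
      fix \<chi>
      have "Y \<chi> * z = (\<Sum>a\<in>?G. f a * (z * \<chi> a))" for z
        unfolding Y_def sum_distrib_right by (simp only: mult_ac)
      then show "(\<Sum>a\<in>?G. f a * (cnj (Y \<chi>) * \<chi> a)) = Y \<chi> * cnj (Y \<chi>)"
        by (rule sym)
    qed
    finally show ?thesis .
  qed
  have h_cnj_h: "h a * cnj (h a) = (\<Sum>\<chi>\<in>X. \<Sum>\<psi>\<in>X. (Y \<chi> * cnj (Y \<psi>)) * (\<psi> a * cnj (\<chi> a))) / \<phi>\<^sup>2" for a
  proof -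
    have "(\<Sum>\<chi>\<in>X. Y \<chi> * cnj (\<chi> a)) * (\<Sum>\<chi>\<in>X. cnj (Y \<chi>) * \<chi> a)
        = (\<Sum>\<chi>\<in>X. \<Sum>\<psi>\<in>X. (Y \<chi> * cnj (Y \<psi>)) * (\<psi> a * cnj (\<chi> a)))"
      unfolding sum_product by (intro sum.cong refl) (simp only: mult_ac)
    then show ?thesis
      unfolding cnj_h unfolding h_def by (simp only: times_divide_times_eq power2_eq_square)
  qed
  have self: "(\<Sum>a\<in>?G. h a * cnj (h a)) = E / \<phi>"
  proof -
    have "(\<Sum>a\<in>?G. h a * cnj (h a))
        = (\<Sum>a\<in>?G. \<Sum>\<chi>\<in>X. \<Sum>\<psi>\<in>X. (Y \<chi> * cnj (Y \<psi>)) * (\<psi> a * cnj (\<chi> a))) / \<phi>\<^sup>2"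
      by (simp only: h_cnj_h sum_divide_distrib[of _ ?G])
    also have "(\<Sum>a\<in>?G. \<Sum>\<chi>\<in>X. \<Sum>\<psi>\<in>X. (Y \<chi> * cnj (Y \<psi>)) * (\<psi> a * cnj (\<chi> a)))
        = (\<Sum>\<chi>\<in>X. \<Sum>\<psi>\<in>X. (Y \<chi> * cnj (Y \<psi>)) * (\<Sum>a\<in>?G. \<psi> a * cnj (\<chi> a)))"
    proof -
      have "(\<Sum>a\<in>?G. \<Sum>\<chi>\<in>X. \<Sum>\<psi>\<in>X. (Y \<chi> * cnj (Y \<psi>)) * (\<psi> a * cnj (\<chi> a)))
          = (\<Sum>\<chi>\<in>X. \<Sum>a\<in>?G. \<Sum>\<psi>\<in>X. (Y \<chi> * cnj (Y \<psi>)) * (\<psi> a * cnj (\<chi> a)))"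
        by (rule sum.swap)
      also have "\<dots> = (\<Sum>\<chi>\<in>X. \<Sum>\<psi>\<in>X. \<Sum>a\<in>?G. (Y \<chi> * cnj (Y \<psi>)) * (\<psi> a * cnj (\<chi> a)))"
        by (intro sum.cong refl sum.swap)
      finally show ?thesis by (simp only: sum_distrib_left)
    qed
    also have "\<dots> = (\<Sum>\<chi>\<in>X. \<Sum>\<psi>\<in>X. if \<psi> = \<chi> then Y \<chi> * cnj (Y \<chi>) * \<phi> else 0)"
    proof (intro sum.cong refl)
      fix \<chi> \<psi> assume "\<chi> \<in> X" "\<psi> \<in> X"
      then have "dirichlet_character q \<chi>" "dirichlet_character q \<psi>" using X by auto
      then show "(Y \<chi> * cnj (Y \<psi>)) * (\<Sum>a\<in>?G. \<psi> a * cnj (\<chi> a))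
        = (if \<psi> = \<chi> then Y \<chi> * cnj (Y \<chi>) * \<phi> else 0)"
        using sum_dirichlet_character_mult_cnj_eq_0[of q \<psi> \<chi>] sum_dirichlet_character_mult_cnj_self[of q \<chi>] q
        by (simp add: \<phi>_def)
    qed
    also have "\<dots> = E * \<phi>" using finX by (simp add: E_def sum_distrib_right)
    also have "E * \<phi> / \<phi>\<^sup>2 = E / \<phi>" using \<phi> by (simp add: power2_eq_square)
    finally show ?thesis .
  qed
  have E_real: "E = of_real (\<Sum>\<chi>\<in>X. (cmod (Y \<chi>))\<^sup>2)"
    unfolding E_def of_real_sum complex_norm_square ..
  have E_cnj: "cnj (E / \<phi>) = E / \<phi>"
    unfolding E_real \<phi>_def by (simp del: of_real_sum)
  have "of_real (\<Sum>a\<in>?G. (cmod (f a - h a))\<^sup>2)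
      = (\<Sum>a\<in>?G. f a * cnj (f a) - f a * cnj (h a) - cnj (f a * cnj (h a)) + h a * cnj (h a))"
    unfolding of_real_sum complex_norm_square by (intro sum.cong refl) (simp add: algebra_simps)
  also have "\<dots> = (\<Sum>a\<in>?G. f a * cnj (f a)) - (\<Sum>a\<in>?G. f a * cnj (h a))
      - cnj (\<Sum>a\<in>?G. f a * cnj (h a)) + (\<Sum>a\<in>?G. h a * cnj (h a))"
    by (simp only: sum_subtractf sum.distrib cnj_sum)
  also have "\<dots> = of_real (\<Sum>a\<in>?G. (cmod (f a))\<^sup>2) - E / \<phi>"
    unfolding cross self of_real_sum complex_norm_square E_cnj by simp
  also have "\<dots> = of_real ((\<Sum>a\<in>?G. (cmod (f a))\<^sup>2) - (\<Sum>\<chi>\<in>X. (cmod (Y \<chi>))\<^sup>2) / real (totient q))"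
    unfolding E_real \<phi>_def by (simp del: of_real_sum)
  finally have "(\<Sum>a\<in>?G. (cmod (f a - h a))\<^sup>2)
      = (\<Sum>a\<in>?G. (cmod (f a))\<^sup>2) - (\<Sum>\<chi>\<in>X. (cmod (Y \<chi>))\<^sup>2) / real (totient q)"
    by (simp only: of_real_eq_iff)
  moreover have "(\<Sum>a\<in>?G. (cmod (f a - h a))\<^sup>2) \<ge> 0" by (intro sum_nonneg) auto
  ultimately have "(\<Sum>\<chi>\<in>X. (cmod (Y \<chi>))\<^sup>2) / real (totient q) \<le> (\<Sum>a\<in>?G. (cmod (f a))\<^sup>2)"
    by linarith
  then have "(\<Sum>\<chi>\<in>X. (cmod (Y \<chi>))\<^sup>2) \<le> (\<Sum>a\<in>?G. (cmod (f a))\<^sup>2) * real (totient q)"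
    using q by (subst (asm) pos_divide_le_eq) auto
  then show ?thesis unfolding Y_def by (simp only: mult.commute)
qed

text \<open>Group the indices by the residue of \<open>s i\<close> and apply Bessel's inequality to
  the fibre sums of \<open>c\<close>. Each fibre sum is at most \<open>A\<close> times the fibre
  size, and the squared fibre sizes add up to the number of congruent pairs.\<close>

lemma mean_square_dirichlet_characters_le:
  fixes s :: "'i \<Rightarrow> int" and c :: "'i \<Rightarrow> complex"
  assumes q: "q \<ge> 1" and X: "X \<subseteq> {\<chi>. dirichlet_character q \<chi>}"
    and I: "finite I" and s: "\<And>i. i \<in> I \<Longrightarrow> coprime (s i) (int q)"
    and c: "\<And>i. i \<in> I \<Longrightarrow> cmod (c i) \<le> A"
  shows "(\<Sum>\<chi>\<in>X. (cmod (\<Sum>i\<in>I. c i * \<chi> (s i)))\<^sup>2)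
      \<le> real (totient q) * A\<^sup>2 * real (card {(i, j). i \<in> I \<and> j \<in> I \<and> [s i = s j] (mod int q)})"
proof -
  let ?G = "residues_coprime q"
  define f where "f a = (\<Sum>i | i \<in> I \<and> s i mod int q = a. c i)" for a
  have sG: "s i mod int q \<in> ?G" if "i \<in> I" for i
    using s[OF that] q by (simp add: residues_coprime_def)
  have eq: "(\<Sum>i\<in>I. c i * \<chi> (s i)) = (\<Sum>a\<in>?G. f a * \<chi> a)" if "\<chi> \<in> X" for \<chi>
  proof -
    have "(\<Sum>i\<in>I. c i * \<chi> (s i)) = (\<Sum>a\<in>?G. \<Sum>i | i \<in> I \<and> s i mod int q = a. c i * \<chi> (s i))"
      using I sG by (intro sum.group[symmetric]) auto
    also have "\<dots> = (\<Sum>a\<in>?G. f a * \<chi> a)"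
    proof (intro sum.cong refl)
      fix a
      have "\<chi> (s i) = \<chi> a" if "s i mod int q = a" for i
        using dirichlet_character_mod[of q \<chi> "s i"] X \<open>\<chi> \<in> X\<close> that by auto
      then show "(\<Sum>i | i \<in> I \<and> s i mod int q = a. c i * \<chi> (s i)) = f a * \<chi> a"
        by (simp add: f_def sum_distrib_right)
    qed
    finally show ?thesis .
  qed
  have "(\<Sum>\<chi>\<in>X. (cmod (\<Sum>i\<in>I. c i * \<chi> (s i)))\<^sup>2) = (\<Sum>\<chi>\<in>X. (cmod (\<Sum>a\<in>?G. f a * \<chi> a))\<^sup>2)"
    by (intro sum.cong refl) (simp add: eq)
  also have "\<dots> \<le> real (totient q) * (\<Sum>a\<in>?G. (cmod (f a))\<^sup>2)"
    by (rule bessel_dirichlet_characters[OF q X])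
  also have "(\<Sum>a\<in>?G. (cmod (f a))\<^sup>2) \<le> (\<Sum>a\<in>?G. A\<^sup>2 * (real (card {i. i \<in> I \<and> s i mod int q = a}))\<^sup>2)"
  proof (intro sum_mono)
    fix a
    have "cmod (f a) \<le> (\<Sum>i | i \<in> I \<and> s i mod int q = a. A)"
      unfolding f_def by (rule sum_norm_le) (use c in auto)
    then have "cmod (f a) \<le> A * real (card {i. i \<in> I \<and> s i mod int q = a})"
      by (simp add: mult.commute)
    then have "(cmod (f a))\<^sup>2 \<le> (A * real (card {i. i \<in> I \<and> s i mod int q = a}))\<^sup>2"
      by (intro power_mono) auto
    then show "(cmod (f a))\<^sup>2 \<le> A\<^sup>2 * (real (card {i. i \<in> I \<and> s i mod int q = a}))\<^sup>2"
      by (simp add: power_mult_distrib)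
  qed
  also have "\<dots> = A\<^sup>2 * real (\<Sum>a\<in>?G. (card {i. i \<in> I \<and> s i mod int q = a})\<^sup>2)"
    by (simp add: sum_distrib_left)
  also have "(\<Sum>a\<in>?G. (card {i. i \<in> I \<and> s i mod int q = a})\<^sup>2)
      = card (\<Union>a\<in>?G. {i. i \<in> I \<and> s i mod int q = a} \<times> {i. i \<in> I \<and> s i mod int q = a})"
    using I by (subst card_UN_disjoint) (auto simp: card_cartesian_product power2_eq_square)
  also have "(\<Union>a\<in>?G. {i. i \<in> I \<and> s i mod int q = a} \<times> {i. i \<in> I \<and> s i mod int q = a})
      = {(i, j). i \<in> I \<and> j \<in> I \<and> [s i = s j] (mod int q)}"
    using sG by (auto simp: cong_def)
  finally show ?thesis
    by (simp add: mult_left_mono mult.assoc)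
qed

section \<open>Multiplicative congruences in short intervals\<close>

lemma card_fibre_product_eq_sum:
  assumes "finite A" "finite B" "finite K" "f ` A \<subseteq> K"
  shows "card {(a, b). a \<in> A \<and> b \<in> B \<and> f a = g b}
    = (\<Sum>k\<in>K. card {a \<in> A. f a = k} * card {b \<in> B. g b = k})"
proof -
  have "{(a, b). a \<in> A \<and> b \<in> B \<and> f a = g b} = (\<Union>k\<in>K. {a \<in> A. f a = k} \<times> {b \<in> B. g b = k})"
    using assms(4) by auto
  then show ?thesis
    using assms(1-3) by (simp add: card_UN_disjoint card_cartesian_product disjoint_iff)
qed

text \<open>The coincidences are counted by the inner product of the fibre sizes of \<open>f\<close>
  and \<open>g\<close>; Cauchy--Schwarz bounds it by the self-coincidences of each map.\<close>

lemma card_fibre_product_le: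
  assumes "finite A" "finite B"
  shows "real (card {(a, b). a \<in> A \<and> b \<in> B \<and> f a = g b})
    \<le> sqrt (real (card {(a, a'). a \<in> A \<and> a' \<in> A \<and> f a = f a'}))
      * sqrt (real (card {(b, b'). b \<in> B \<and> b' \<in> B \<and> g b = g b'}))"
proof -
  define K where "K = f ` A \<union> g ` B"
  have K: "finite K" "f ` A \<subseteq> K" "g ` B \<subseteq> K" using assms by (auto simp: K_def)
  let ?\<alpha> = "\<lambda>k. real (card {a \<in> A. f a = k})" and ?\<beta> = "\<lambda>k. real (card {b \<in> B. g b = k})"
  have "(\<Sum>k\<in>K. ?\<alpha> k * ?\<beta> k)\<^sup>2 \<le> (\<Sum>k\<in>K. (?\<alpha> k)\<^sup>2) * (\<Sum>k\<in>K. (?\<beta> k)\<^sup>2)"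
    by (rule Cauchy_Schwarz_ineq_sum)
  then have "(\<Sum>k\<in>K. ?\<alpha> k * ?\<beta> k) \<le> sqrt ((\<Sum>k\<in>K. (?\<alpha> k)\<^sup>2) * (\<Sum>k\<in>K. (?\<beta> k)\<^sup>2))"
    by (rule real_le_rsqrt)
  then show ?thesis
    by (simp add: card_fibre_product_eq_sum[OF assms(1,2) K(1,2)]
        card_fibre_product_eq_sum[OF assms(1,1) K(1,2)] card_fibre_product_eq_sum[OF assms(2,2) K(1,3)]
        real_sqrt_mult power2_eq_square)
qed

lemma finite_interval_filter: "finite {f \<in> {a..b::int}. P f}"
  by (rule finite_subset[of _ "{a..b}"]) auto

text \<open>Members of one residue class have equal remainders after subtracting a, so the quotient
  by r tells them apart; it takes at most (b - a) div r + 1 values.\<close>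

lemma card_cong_interval_le:
  fixes a b c r :: int
  assumes "r \<ge> 1" "a \<le> b"
  shows "real (card {f \<in> {a..b}. [f = c] (mod r)}) \<le> real_of_int (b - a) / real_of_int r + 1"
proof -
  let ?S = "{f \<in> {a..b}. [f = c] (mod r)}"
  have "inj_on (\<lambda>f. (f - a) div r) ?S"
  proof (rule inj_onI)
    fix x y assume "x \<in> ?S" "y \<in> ?S" and eq: "(x - a) div r = (y - a) div r"
    then have "[x - a = y - a] (mod r)"
      by (intro cong_diff) (auto simp: cong_def)
    then have "x - a = y - a"
      using eq unfolding cong_def by (metis div_mult_mod_eq)
    then show "x = y" by simp
  qed
  moreover have "(\<lambda>f. (f - a) div r) ` ?S \<subseteq> {0..(b - a) div r}"
    using assms by (auto intro!: zdiv_mono1 simp: pos_imp_zdiv_nonneg_iff)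
  ultimately have "card ?S \<le> card {0..(b - a) div r}"
    by (intro card_inj_on_le) auto
  then have "real (card ?S) \<le> real_of_int ((b - a) div r) + 1"
    using assms pos_imp_zdiv_nonneg_iff[of r "b - a"] by simp
  also have "real_of_int ((b - a) div r) \<le> real_of_int (b - a) / real_of_int r"
    by (rule real_of_int_div4)
  finally show ?thesis by simp
qed

text \<open>The first factor determines the second because e is nonzero, and it is a positive or
  negative divisor of e, whence the 2.\<close>

lemma card_factorizations_le:
  fixes e :: int
  assumes "e \<noteq> 0"
  shows "card {p \<in> U \<times> U. fst p * snd p = e} \<le> 2 * card {d. d dvd nat \<bar>e\<bar>}"
proof -
  let ?D = "{d. d dvd nat \<bar>e\<bar>}"
  have fin: "finite ?D" using assms by (intro finite_divisors_nat) simp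
  have "card {p \<in> U \<times> U. fst p * snd p = e} \<le> card (int ` ?D \<union> (\<lambda>d. - int d) ` ?D)"
  proof (rule card_inj_on_le[where f = fst])
    show "inj_on fst {p \<in> U \<times> U. fst p * snd p = e}"
      using assms by (auto simp: inj_on_def)
    show "fst ` {p \<in> U \<times> U. fst p * snd p = e} \<subseteq> int ` ?D \<union> (\<lambda>d. - int d) ` ?D"
    proof
      fix a assume "a \<in> fst ` {p \<in> U \<times> U. fst p * snd p = e}"
      then have "a dvd e" by auto
      then have "nat \<bar>a\<bar> \<in> ?D" by (simp add: nat_abs_dvd_iff)
      moreover have "a = int (nat \<bar>a\<bar>) \<or> a = - int (nat \<bar>a\<bar>)" by linarith
      ultimately show "a \<in> int ` ?D \<union> (\<lambda>d. - int d) ` ?D" by blast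
    qed
    show "finite (int ` ?D \<union> (\<lambda>d. - int d) ` ?D)" using fin by simp
  qed
  also have "\<dots> \<le> card (int ` ?D) + card ((\<lambda>d. - int d) ` ?D)" by (rule card_Un_le)
  also have "\<dots> \<le> card ?D + card ?D" by (intro add_mono card_image_le fin)
  finally show ?thesis by simp
qed

text \<open>Passing from pairs to their products merges at most \<open>F\<close> pairs into one
  value on each side. This trades four variables for two, at the cost of a divisor bound.\<close>

lemma card_product_pairs_le:
  fixes U S :: "int set" and P :: "int \<Rightarrow> int \<Rightarrow> bool"
  assumes U: "finite U" and S: "finite S" "\<And>a b. a \<in> U \<Longrightarrow> b \<in> U \<Longrightarrow> a * b \<in> S"
    and F: "\<And>e. e \<in> S \<Longrightarrow> card {p \<in> U \<times> U. fst p * snd p = e} \<le> F"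
  shows "card {(p, p'). p \<in> U \<times> U \<and> p' \<in> U \<times> U \<and> P (fst p * snd p) (fst p' * snd p')}
    \<le> F\<^sup>2 * card {(e, f). e \<in> S \<and> f \<in> S \<and> P e f}"
proof -
  let ?fib = "\<lambda>e. {p \<in> U \<times> U. fst p * snd p = e}"
  let ?Q = "{(e, f). e \<in> S \<and> f \<in> S \<and> P e f}"
  have fin: "finite ?Q" by (rule finite_subset[of _ "S \<times> S"]) (use S in auto)
  have "{(p, p'). p \<in> U \<times> U \<and> p' \<in> U \<times> U \<and> P (fst p * snd p) (fst p' * snd p')}
    \<subseteq> (\<Union>ef\<in>?Q. ?fib (fst ef) \<times> ?fib (snd ef))"
    using S(2) by auto
  then have "card {(p, p'). p \<in> U \<times> U \<and> p' \<in> U \<times> U \<and> P (fst p * snd p) (fst p' * snd p')}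
    \<le> card (\<Union>ef\<in>?Q. ?fib (fst ef) \<times> ?fib (snd ef))"
    using fin U by (intro card_mono) auto
  also have "\<dots> \<le> (\<Sum>ef\<in>?Q. card (?fib (fst ef) \<times> ?fib (snd ef)))"
    by (rule card_UN_le[OF fin])
  also have "\<dots> \<le> (\<Sum>ef\<in>?Q. F * F)"
    using F by (intro sum_mono) (auto simp: card_cartesian_product intro!: mult_mono)
  finally show ?thesis by (simp add: power2_eq_square mult.commute)
qed

lemma card_pairs_le:
  assumes "finite S" "\<And>e. e \<in> S \<Longrightarrow> real (card {f \<in> S. P e f}) \<le> c"
  shows "real (card {(e, f). e \<in> S \<and> f \<in> S \<and> P e f}) \<le> real (card S) * c"
proof -
  have "{(e, f). e \<in> S \<and> f \<in> S \<and> P e f} = Sigma S (\<lambda>e. {f \<in> S. P e f})" by auto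
  then have "real (card {(e, f). e \<in> S \<and> f \<in> S \<and> P e f}) = (\<Sum>e\<in>S. real (card {f \<in> S. P e f}))"
    using assms(1) by (simp add: card_SigmaI)
  also have "\<dots> \<le> (\<Sum>e\<in>S. c)" by (intro sum_mono assms(2))
  finally show ?thesis by simp
qed

text \<open>Products lie among the 2 H^2 nonzero integers up to H^2 in size, each with at most 2 T
  factorizations and at most 2 H^2 / r + 1 integers in that range congruent to it.\<close>

lemma card_cong_products_le:
  fixes U :: "int set"
  assumes U: "\<And>u. u \<in> U \<Longrightarrow> u \<noteq> 0 \<and> \<bar>u\<bar> \<le> int H" and "r \<ge> 1" "H \<ge> 1"
    and T: "\<And>n. 1 \<le> n \<Longrightarrow> n \<le> H\<^sup>2 \<Longrightarrow> card {d. d dvd n} \<le> T"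
  shows "real (card {(p, p'). p \<in> U \<times> U \<and> p' \<in> U \<times> U \<and> [fst p * snd p = fst p' * snd p'] (mod int r)})
    \<le> 16 * (real T)\<^sup>2 * (real H ^ 2 + real H ^ 4 / real r)"
proof -
  define E where "E = int H ^ 2"
  have E: "E \<ge> 1" using \<open>H \<ge> 1\<close> by (simp add: E_def)
  define S where "S = {e. e \<noteq> 0 \<and> \<bar>e\<bar> \<le> E}"
  have Seq: "S = {-E..E} - {0}" by (auto simp: S_def)
  have finS: "finite S" by (simp add: Seq)
  have cardS: "real (card S) = 2 * real H ^ 2" using E by (simp add: Seq E_def)
  have finU: "finite U" by (rule finite_subset[of _ "{-int H..int H}"]) (use U in force)+
  have "card {(p, p'). p \<in> U \<times> U \<and> p' \<in> U \<times> U \<and> [fst p * snd p = fst p' * snd p'] (mod int r)}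
    \<le> (2 * T)\<^sup>2 * card {(e, f). e \<in> S \<and> f \<in> S \<and> [e = f] (mod int r)}"
  proof (rule card_product_pairs_le[OF finU finS])
    fix a b assume ab: "a \<in> U" "b \<in> U"
    have "\<bar>a\<bar> * \<bar>b\<bar> \<le> int H * int H" using U[OF ab(1)] U[OF ab(2)] by (intro mult_mono) auto
    then show "a * b \<in> S" using U[OF ab(1)] U[OF ab(2)]
      by (simp add: S_def E_def abs_mult power2_eq_square)
  next
    fix e assume e: "e \<in> S"
    then have "1 \<le> nat \<bar>e\<bar>" "nat \<bar>e\<bar> \<le> H\<^sup>2" by (auto simp: S_def E_def nat_le_iff)
    then have "card {d. d dvd nat \<bar>e\<bar>} \<le> T" by (rule T)
    then show "card {p \<in> U \<times> U. fst p * snd p = e} \<le> 2 * T"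
      using card_factorizations_le[of e U] e by (simp add: S_def)
  qed
  then have "real (card {(p, p'). p \<in> U \<times> U \<and> p' \<in> U \<times> U \<and> [fst p * snd p = fst p' * snd p'] (mod int r)})
    \<le> real ((2 * T)\<^sup>2 * card {(e, f). e \<in> S \<and> f \<in> S \<and> [e = f] (mod int r)})"
    by (simp only: of_nat_le_iff)
  also have "\<dots> = 4 * (real T)\<^sup>2 * real (card {(e, f). e \<in> S \<and> f \<in> S \<and> [e = f] (mod int r)})"
    by (simp add: power2_eq_square)
  also have "real (card {(e, f). e \<in> S \<and> f \<in> S \<and> [e = f] (mod int r)})
    \<le> real (card S) * (2 * real H ^ 2 / real r + 1)"
  proof (rule card_pairs_le[OF finS])
    fix e
    have "card {f \<in> S. [e = f] (mod int r)} \<le> card {f \<in> {-E..E}. [f = e] (mod int r)}"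
      by (intro card_mono finite_interval_filter) (auto simp: S_def cong_sym)
    also have "real \<dots> \<le> real_of_int (E - (-E)) / real_of_int (int r) + 1"
      using E \<open>r \<ge> 1\<close> by (intro card_cong_interval_le) auto
    finally show "real (card {f \<in> S. [e = f] (mod int r)}) \<le> 2 * real H ^ 2 / real r + 1"
      by (simp add: E_def)
  qed
  also have "4 * (real T)\<^sup>2 * (real (card S) * (2 * real H ^ 2 / real r + 1))
    = 16 * (real T)\<^sup>2 * (real H ^ 4 / real r) + 8 * (real T)\<^sup>2 * real H ^ 2"
    unfolding cardS by (simp add: algebra_simps power_numeral_reduce)
  also have "\<dots> \<le> 16 * (real T)\<^sup>2 * (real H ^ 2 + real H ^ 4 / real r)"
    by (simp add: algebra_simps)
  finally show ?thesis by (simp add: mult_left_mono)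
qed

text \<open>If \<open>e\<^sup>2 \<equiv> f\<^sup>2\<close> modulo \<open>q\<close>, then \<open>a = gcd q (e - f)\<close> splits \<open>q = a b\<close> with
  \<open>f \<equiv> e\<close> modulo \<open>a\<close> and \<open>f \<equiv> - e\<close> modulo \<open>b\<close>. As \<open>gcd a b\<close> divides \<open>2 e\<close>, it divides 2, so these two
  conditions determine \<open>2 f\<close> modulo \<open>q\<close>.\<close>

lemma card_cong_square_le:
  fixes e :: int
  assumes "q \<ge> 1" "E \<ge> 1" and e: "coprime e (int q)"
  shows "real (card {f \<in> {1..int E}. [e\<^sup>2 = f\<^sup>2] (mod int q)})
    \<le> real (card {d. d dvd q}) * (2 * real E / real q + 1)"
proof -
  let ?W = "\<lambda>a. {f \<in> {1..int E}. [f = e] (mod int a) \<and> [f = - e] (mod int (q div a))}"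
  have fin: "finite {d. d dvd q}" using \<open>q \<ge> 1\<close> by simp
  have sub: "{f \<in> {1..int E}. [e\<^sup>2 = f\<^sup>2] (mod int q)} \<subseteq> (\<Union>a\<in>{d. d dvd q}. ?W a)"
  proof
    fix f assume f: "f \<in> {f \<in> {1..int E}. [e\<^sup>2 = f\<^sup>2] (mod int q)}"
    define a where "a = nat (gcd (int q) (f - e))"
    have ia: "int a = gcd (int q) (f - e)" by (simp add: a_def)
    have "int a dvd int q" unfolding ia by simp
    then have aq: "a dvd q" by simp
    have a0: "int a \<noteq> 0" unfolding ia using \<open>q \<ge> 1\<close> by simp
    have "int q dvd f\<^sup>2 - e\<^sup>2" using f by (simp add: cong_iff_dvd_diff dvd_diff_commute)
    then have "int q dvd (f - e) * (f + e)" by (simp add: algebra_simps power2_eq_square)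
    moreover have "int a * int (q div a) = int q"
      using aq by (metis dvd_mult_div_cancel of_nat_mult)
    moreover have "int a * ((f - e) div int a) = f - e"
      by (rule dvd_mult_div_cancel) (simp add: ia)
    ultimately have "int a * int (q div a) dvd int a * ((f - e) div int a) * (f + e)"
      by simp
    then have "int (q div a) dvd ((f - e) div int a) * (f + e)"
      using a0 by (simp add: mult.assoc)
    moreover have "coprime (int (q div a)) ((f - e) div int a)"
      using a0 div_gcd_coprime[of "int q" "f - e"] \<open>q \<ge> 1\<close> by (simp add: ia zdiv_int)
    ultimately have "int (q div a) dvd f + e" by (simp add: coprime_dvd_mult_right_iff)
    moreover have "int a dvd f - e" by (simp add: ia)
    ultimately have "f \<in> ?W a" using f by (simp add: cong_iff_dvd_diff)
    with aq show "f \<in> (\<Union>a\<in>{d. d dvd q}. ?W a)" by blast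
  qed
  have W: "real (card (?W a)) \<le> 2 * real E / real q + 1" if aq: "a dvd q" for a
  proof (cases "?W a = {}")
    case True
    then show ?thesis by (simp only: card.empty) simp
  next
    case False
    then obtain f0 where f0: "f0 \<in> ?W a" by blast
    define b where "b = q div a"
    have q: "int q = int a * int b" using aq by (simp add: b_def flip: of_nat_mult)
    define g where "g = gcd (int a) (int b)"
    have "int a dvd f0 - e" "int b dvd f0 + e"
      using f0 by (auto simp: cong_iff_dvd_diff b_def)
    moreover have "g dvd int a" "g dvd int b" by (simp_all add: g_def)
    ultimately have "g dvd f0 - e" "g dvd f0 + e" using dvd_trans by blast+
    then have "g dvd (f0 + e) - (f0 - e)" by (rule dvd_diff[rotated])
    then have "g dvd 2 * e" by simp
    moreover have "coprime g e"
    proof -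
      have "g dvd int q" unfolding q g_def by simp
      then show ?thesis
        using coprime_divisors[of g "int q" e e] e by (simp add: coprime_commute)
    qed
    ultimately have g2: "g dvd 2" by (simp add: coprime_dvd_mult_left_iff)
    \<comment> \<open>Being congruent to e modulo a and to - e modulo b fixes f modulo lcm a b.
      Since g divides 2 and g times the lcm is q, the double of f is fixed modulo q.\<close>
    have two: "[2 * f = 2 * f0] (mod int q)" if "f \<in> ?W a" for f
    proof -
      have "[f = f0] (mod int a)" "[f = f0] (mod int b)"
        using that f0 unfolding b_def by (auto simp: cong_def)
      then have "lcm (int a) (int b) dvd f - f0" unfolding cong_iff_dvd_diff by (rule lcm_least)
      then have "g * lcm (int a) (int b) dvd 2 * (f - f0)"
        using g2 by (rule mult_dvd_mono[rotated])
      moreover have "g * lcm (int a) (int b) = int q"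
        unfolding q g_def using prod_gcd_lcm_int[of "int a" "int b"]
        by (metis abs_of_nat)
      ultimately show ?thesis by (simp add: cong_iff_dvd_diff right_diff_distrib)
    qed
    \<comment> \<open>Doubling maps \<open>?W a\<close> injectively into one residue class modulo q
      on an interval of twice the length, whence the 2 in the bound.\<close>
    have "card (?W a) \<le> card {f \<in> {1..2 * int E}. [f = 2 * f0] (mod int q)}"
      by (rule card_inj_on_le[where f = "\<lambda>f. 2 * f", OF _ _ finite_interval_filter])
        (use two in \<open>auto simp: inj_on_def\<close>)
    also have "real \<dots> \<le> real_of_int (2 * int E - 1) / real_of_int (int q) + 1"
      using \<open>q \<ge> 1\<close> \<open>E \<ge> 1\<close> by (intro card_cong_interval_le) auto
    also have "\<dots> \<le> 2 * real E / real q + 1" by (simp add: divide_right_mono)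
    finally show ?thesis by simp
  qed
  have "card {f \<in> {1..int E}. [e\<^sup>2 = f\<^sup>2] (mod int q)} \<le> card (\<Union>a\<in>{d. d dvd q}. ?W a)"
  proof (rule card_mono[OF _ sub])
    show "finite (\<Union>a\<in>{d. d dvd q}. ?W a)"
      by (rule finite_subset[of _ "{1..int E}"]) auto
  qed
  also have "\<dots> \<le> (\<Sum>a | a dvd q. card (?W a))" by (rule card_UN_le[OF fin])
  finally have "real (card {f \<in> {1..int E}. [e\<^sup>2 = f\<^sup>2] (mod int q)}) \<le> (\<Sum>a | a dvd q. real (card (?W a)))"
    by (simp only: of_nat_sum[symmetric] of_nat_le_iff)
  also have "\<dots> \<le> (\<Sum>a | a dvd q. 2 * real E / real q + 1)"
    by (intro sum_mono W) simp
  finally show ?thesis by simp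
qed

text \<open>Products of two elements of \<open>D\<close> are units up to E = 4 K^2 with at most 2 T
  factorizations each, and the square congruence leaves at most \<tau>(q) (2 E / q + 1) partners.
  The constant 128 is 4 * 4 * 8.\<close>

lemma card_cong_square_products_le:
  fixes D :: "int set"
  assumes D: "\<And>d. d \<in> D \<Longrightarrow> 1 \<le> d \<and> d \<le> 2 * int K \<and> coprime d (int q)" and "q \<ge> 1" "K \<ge> 1"
    and T: "\<And>n. 1 \<le> n \<Longrightarrow> n \<le> 4 * K\<^sup>2 \<Longrightarrow> card {d. d dvd n} \<le> T"
  shows "real (card {(p, p'). p \<in> D \<times> D \<and> p' \<in> D \<times> D \<and>
      [(fst p * snd p)\<^sup>2 = (fst p' * snd p')\<^sup>2] (mod int q)})
    \<le> 128 * (real T)\<^sup>2 * real (card {d. d dvd q}) * (real K ^ 2 + real K ^ 4 / real q)"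
proof -
  define E where "E = 4 * K\<^sup>2"
  have E: "E \<ge> 1" using \<open>K \<ge> 1\<close> by (simp add: E_def)
  define S where "S = {e \<in> {1..int E}. coprime e (int q)}"
  have finS: "finite S" by (rule finite_subset[of _ "{1..int E}"]) (auto simp: S_def)
  have "card S \<le> card {1..int E}" by (intro card_mono) (auto simp: S_def)
  then have cardS: "card S \<le> E" by simp
  have finD: "finite D" by (rule finite_subset[of _ "{1..2 * int K}"]) (use D in force)+
  let ?\<tau> = "real (card {d. d dvd q})"
  have "card {(p, p'). p \<in> D \<times> D \<and> p' \<in> D \<times> D \<and> [(fst p * snd p)\<^sup>2 = (fst p' * snd p')\<^sup>2] (mod int q)}
    \<le> (2 * T)\<^sup>2 * card {(e, f). e \<in> S \<and> f \<in> S \<and> [e\<^sup>2 = f\<^sup>2] (mod int q)}"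
  proof (rule card_product_pairs_le[OF finD finS])
    fix a b assume ab: "a \<in> D" "b \<in> D"
    have "a * b \<le> (2 * int K) * (2 * int K)" using D[OF ab(1)] D[OF ab(2)] by (intro mult_mono) auto
    moreover have "0 < a * b" using D[OF ab(1)] D[OF ab(2)] by (intro mult_pos_pos) auto
    ultimately show "a * b \<in> S" using D[OF ab(1)] D[OF ab(2)]
      by (simp add: S_def E_def power2_eq_square int_one_le_iff_zero_less)
  next
    fix e assume e: "e \<in> S"
    then have "1 \<le> nat \<bar>e\<bar>" "nat \<bar>e\<bar> \<le> 4 * K\<^sup>2" by (auto simp: S_def E_def nat_le_iff)
    then have "card {d. d dvd nat \<bar>e\<bar>} \<le> T" by (rule T)
    then show "card {p \<in> D \<times> D. fst p * snd p = e} \<le> 2 * T"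
      using card_factorizations_le[of e D] e by (simp add: S_def)
  qed
  then have "real (card {(p, p'). p \<in> D \<times> D \<and> p' \<in> D \<times> D \<and>
      [(fst p * snd p)\<^sup>2 = (fst p' * snd p')\<^sup>2] (mod int q)})
    \<le> real ((2 * T)\<^sup>2 * card {(e, f). e \<in> S \<and> f \<in> S \<and> [e\<^sup>2 = f\<^sup>2] (mod int q)})"
    by (simp only: of_nat_le_iff)
  also have "\<dots> = 4 * (real T)\<^sup>2 * real (card {(e, f). e \<in> S \<and> f \<in> S \<and> [e\<^sup>2 = f\<^sup>2] (mod int q)})"
    by (simp add: power2_eq_square)
  also have "real (card {(e, f). e \<in> S \<and> f \<in> S \<and> [e\<^sup>2 = f\<^sup>2] (mod int q)})
    \<le> real (card S) * (?\<tau> * (2 * real E / real q + 1))"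
  proof (rule card_pairs_le[OF finS])
    fix e assume "e \<in> S"
    have "card {f \<in> S. [e\<^sup>2 = f\<^sup>2] (mod int q)} \<le> card {f \<in> {1..int E}. [e\<^sup>2 = f\<^sup>2] (mod int q)}"
      by (intro card_mono finite_interval_filter) (auto simp: S_def)
    also have "real \<dots> \<le> ?\<tau> * (2 * real E / real q + 1)"
      using \<open>e \<in> S\<close> by (intro card_cong_square_le assms(2) E) (simp add: S_def)
    finally show "real (card {f \<in> S. [e\<^sup>2 = f\<^sup>2] (mod int q)}) \<le> ?\<tau> * (2 * real E / real q + 1)"
      by simp
  qed
  also have "real (card S) * (?\<tau> * (2 * real E / real q + 1)) \<le> real E * (?\<tau> * (2 * real E / real q + 1))"
    using cardS by (intro mult_right_mono) auto
  also have "4 * (real T)\<^sup>2 * (real E * (?\<tau> * (2 * real E / real q + 1)))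
    = (real T)\<^sup>2 * ?\<tau> * (128 * (real K ^ 4 / real q) + 16 * real K ^ 2)"
    unfolding E_def by (simp add: algebra_simps power_numeral_reduce)
  also have "\<dots> \<le> (real T)\<^sup>2 * ?\<tau> * (128 * (real K ^ 4 / real q) + 128 * real K ^ 2)"
    by (intro mult_left_mono) auto
  also have "\<dots> = 128 * (real T)\<^sup>2 * ?\<tau> * (real K ^ 2 + real K ^ 4 / real q)"
    by (simp add: algebra_simps)
  finally show ?thesis by (simp add: mult_left_mono)
qed

text \<open>Cross-multiplication of fractions modulo m. The quotient form separates variables for
  Cauchy--Schwarz, while the product form is the one that divisor bounds count.\<close>

lemma cong_mult_inverse_iff:
  fixes x y z t :: int
  assumes "[y * y' = 1] (mod m)" "[t * t' = 1] (mod m)"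
  shows "[x * y' = z * t'] (mod m) \<longleftrightarrow> [x * t = z * y] (mod m)"
proof
  assume "[x * y' = z * t'] (mod m)"
  then have "[(x * y') * (y * t) = (z * t') * (y * t)] (mod m)" by (rule cong_scalar_right)
  moreover have "[(x * t) * (y * y') = (x * t) * 1] (mod m)" "[(z * y) * (t * t') = (z * y) * 1] (mod m)"
    by (rule cong_scalar_left[OF assms(1)], rule cong_scalar_left[OF assms(2)])
  ultimately show "[x * t = z * y] (mod m)" by (simp add: cong_def mult_ac)
next
  assume "[x * t = z * y] (mod m)"
  then have "[(x * t) * (y' * t') = (z * y) * (y' * t')] (mod m)" by (rule cong_scalar_right)
  moreover have "[(x * y') * (t * t') = (x * y') * 1] (mod m)" "[(z * t') * (y * y') = (z * t') * 1] (mod m)"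
    by (rule cong_scalar_left[OF assms(2)], rule cong_scalar_left[OF assms(1)])
  ultimately show "[x * y' = z * t'] (mod m)" by (simp add: cong_def mult_ac)
qed

text \<open>The congruence \<open>d\<^sub>1\<^sup>2 w\<^sub>1 \<equiv> d\<^sub>2\<^sup>2 w\<^sub>2\<close>, written as \<open>(d\<^sub>1 / d\<^sub>2)\<^sup>2 \<equiv> w\<^sub>2 / w\<^sub>1\<close>, separates the
  variables, so that Cauchy--Schwarz applies.\<close>

lemma card_cong_square_mult_le:
  fixes D :: "int set" and w :: "'u \<Rightarrow> int"
  assumes fin: "finite D" "finite U"
    and D: "\<And>d. d \<in> D \<Longrightarrow> coprime d (int q)" and w: "\<And>u. u \<in> U \<Longrightarrow> coprime (w u) (int q)"
  shows "real (card {(i, j). i \<in> D \<times> U \<and> j \<in> D \<times> U \<and>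
      [(fst i)\<^sup>2 * w (snd i) = (fst j)\<^sup>2 * w (snd j)] (mod int q)})
    \<le> sqrt (real (card {(p, p'). p \<in> D \<times> D \<and> p' \<in> D \<times> D \<and>
          [(fst p * snd p)\<^sup>2 = (fst p' * snd p')\<^sup>2] (mod int q)}))
      * sqrt (real (card {(p, p'). p \<in> U \<times> U \<and> p' \<in> U \<times> U \<and>
          [w (fst p) * w (snd p) = w (fst p') * w (snd p')] (mod int q)}))"
    (is "real (card ?J) \<le> sqrt (real (card ?ED)) * sqrt (real (card ?EU))")
proof -
  obtain v where v: "\<And>a. coprime a (int q) \<Longrightarrow> [a * v a = 1] (mod int q)"
    using cong_solve_coprime_int[of _ "int q"] by metis
  \<comment> \<open>\<open>f\<close> is the quotient of two squares and \<open>g\<close> the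
    quotient of two values of \<open>w\<close>, reduced so that congruence becomes equality.\<close>
  define f where "f p = ((fst p)\<^sup>2 * v ((snd p)\<^sup>2)) mod int q" for p :: "int \<times> int"
  define g where "g p = (w (fst p) * v (w (snd p))) mod int q" for p :: "'u \<times> 'u"
  have D2: "[d\<^sup>2 * v (d\<^sup>2) = 1] (mod int q)" if "d \<in> D" for d using D[OF that] by (intro v) simp
  have U2: "[w u * v (w u) = 1] (mod int q)" if "u \<in> U" for u using w[OF that] by (intro v)
  let ?F = "{(a, b). a \<in> D \<times> D \<and> b \<in> U \<times> U \<and> f a = g b}"
  let ?FF = "{(a, b). a \<in> D \<times> D \<and> b \<in> D \<times> D \<and> f a = f b}"
  let ?GG = "{(a, b). a \<in> U \<times> U \<and> b \<in> U \<times> U \<and> g a = g b}"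
  have finF: "finite ?F"
    by (rule finite_subset[of _ "(D \<times> D) \<times> (U \<times> U)"]) (use fin in auto)
  have finED: "finite ?ED"
    by (rule finite_subset[of _ "(D \<times> D) \<times> (D \<times> D)"]) (use fin in auto)
  have finEU: "finite ?EU"
    by (rule finite_subset[of _ "(U \<times> U) \<times> (U \<times> U)"]) (use fin in auto)
  have "card ?J \<le> card ?F"
  proof (rule card_inj_on_le[OF _ _ finF])
    \<comment> \<open>The second components are interchanged because the congruence equates (d /
      d')^2 with w u' / w u. The two rearrangements below likewise clear denominators, from a / b =
      c / d to a d = c b.\<close>
    show "inj_on (\<lambda>((d, u), (d', u')). ((d, d'), (u', u))) ?J" by (auto simp: inj_on_def)
    have "((d, d'), (u', u)) \<in> ?F" if "((d, u), (d', u')) \<in> ?J" for d u d' u'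
      using that cong_mult_inverse_iff[OF D2 U2, of d' u "d\<^sup>2" "w u'"]
      by (simp add: f_def g_def cong_def mult.commute[of "d'\<^sup>2"])
    then show "(\<lambda>((d, u), (d', u')). ((d, d'), (u', u))) ` ?J \<subseteq> ?F" by fast
  qed
  moreover have "card ?FF \<le> card ?ED"
  proof (rule card_inj_on_le[OF _ _ finED])
    show "inj_on (\<lambda>((a, b), (c, d)). ((a, d), (c, b))) ?FF" by (auto simp: inj_on_def)
    have "((a, d), (c, b)) \<in> ?ED" if "((a, b), (c, d)) \<in> ?FF" for a b c d
      using that cong_mult_inverse_iff[OF D2 D2, of b d "a\<^sup>2" "c\<^sup>2"]
      by (simp add: f_def cong_def power_mult_distrib)
    then show "(\<lambda>((a, b), (c, d)). ((a, d), (c, b))) ` ?FF \<subseteq> ?ED" by fast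
  qed
  moreover have "card ?GG \<le> card ?EU"
  proof (rule card_inj_on_le[OF _ _ finEU])
    show "inj_on (\<lambda>((a, b), (c, d)). ((a, d), (c, b))) ?GG" by (auto simp: inj_on_def)
    have "((a, d), (c, b)) \<in> ?EU" if "((a, b), (c, d)) \<in> ?GG" for a b c d
      using that cong_mult_inverse_iff[OF U2 U2, of b d "w a" "w c"]
      by (simp add: g_def cong_def)
    then show "(\<lambda>((a, b), (c, d)). ((a, d), (c, b))) ` ?GG \<subseteq> ?EU" by fast
  qed
  moreover have "real (card ?F) \<le> sqrt (real (card ?FF)) * sqrt (real (card ?GG))"
    using card_fibre_product_le[of "D \<times> D" "U \<times> U" f g] fin by simp
  moreover have "sqrt (real (card ?FF)) * sqrt (real (card ?GG)) \<le> sqrt (real (card ?ED)) * sqrt (real (card ?EU))"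
    if "card ?FF \<le> card ?ED" "card ?GG \<le> card ?EU"
    using that by (intro mult_mono real_sqrt_le_mono) auto
  ultimately show ?thesis by (meson of_nat_le_iff order_trans)
qed

text \<open>Mean square by congruent pairs, followed by separation of variables. The energies are
  bounded by squares because they enter through square roots. A general map \<open>w\<close> covers
  both intervals and, in the dual case, inverses of frequencies.\<close>

lemma mean_square_bilinear_le:
  fixes D :: "int set" and w :: "'u \<Rightarrow> int" and c :: "int \<Rightarrow> 'u \<Rightarrow> complex"
  assumes q: "q \<ge> 1" and X: "X \<subseteq> {\<chi>. dirichlet_character q \<chi>}"
    and fin: "finite D" "finite U"
    and D: "\<And>d. d \<in> D \<Longrightarrow> coprime d (int q)" and w: "\<And>u. u \<in> U \<Longrightarrow> coprime (w u) (int q)"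
    and c: "\<And>d u. d \<in> D \<Longrightarrow> u \<in> U \<Longrightarrow> cmod (c d u) \<le> A"
    and ED: "real (card {(p, p'). p \<in> D \<times> D \<and> p' \<in> D \<times> D \<and>
          [(fst p * snd p)\<^sup>2 = (fst p' * snd p')\<^sup>2] (mod int q)}) \<le> e\<^sub>D\<^sup>2" and "e\<^sub>D \<ge> 0"
    and EU: "real (card {(p, p'). p \<in> U \<times> U \<and> p' \<in> U \<times> U \<and>
          [w (fst p) * w (snd p) = w (fst p') * w (snd p')] (mod int q)}) \<le> e\<^sub>U\<^sup>2" and "e\<^sub>U \<ge> 0"
  shows "(\<Sum>\<chi>\<in>X. (cmod (\<Sum>d\<in>D. \<Sum>u\<in>U. c d u * \<chi> (d\<^sup>2 * w u)))\<^sup>2)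
    \<le> real (totient q) * (A\<^sup>2 * (e\<^sub>D * e\<^sub>U))"
proof -
  let ?J = "{(i, j). i \<in> D \<times> U \<and> j \<in> D \<times> U \<and>
      [(fst i)\<^sup>2 * w (snd i) = (fst j)\<^sup>2 * w (snd j)] (mod int q)}"
  have "(\<Sum>\<chi>\<in>X. (cmod (\<Sum>d\<in>D. \<Sum>u\<in>U. c d u * \<chi> (d\<^sup>2 * w u)))\<^sup>2)
      = (\<Sum>\<chi>\<in>X. (cmod (\<Sum>i\<in>D \<times> U. c (fst i) (snd i) * \<chi> ((fst i)\<^sup>2 * w (snd i))))\<^sup>2)"
    by (simp add: sum.cartesian_product case_prod_unfold)
  also have "\<dots> \<le> real (totient q) * A\<^sup>2 * real (card ?J)"
    using fin D w c by (intro mean_square_dirichlet_characters_le[OF q X]) auto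
  also have "\<dots> \<le> real (totient q) * A\<^sup>2 * (e\<^sub>D * e\<^sub>U)"
  proof (intro mult_left_mono)
    show "real (card ?J) \<le> e\<^sub>D * e\<^sub>U"
      by (rule order_trans[OF card_cong_square_mult_le[OF fin D w]])
        (use \<open>e\<^sub>D \<ge> 0\<close> \<open>e\<^sub>U \<ge> 0\<close> in \<open>auto intro!: mult_mono real_le_lsqrt ED EU\<close>)
  qed auto
  finally show ?thesis by (simp add: mult.assoc)
qed

section \<open>Additive characters and Gauss sums\<close>

definition additive_character :: "nat \<Rightarrow> int \<Rightarrow> complex" where
  "additive_character q h = cis (2 * pi * (of_int h / of_nat q))"

lemma additive_character_add:
  "additive_character q (a + b) = additive_character q a * additive_character q b"
  by (simp add: additive_character_def cis_mult add_divide_distrib distrib_left)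

lemma norm_additive_character [simp]: "cmod (additive_character q a) = 1"
  by (simp add: additive_character_def)

lemma cnj_additive_character: "cnj (additive_character q a) = additive_character q (- a)"
  by (simp add: additive_character_def cis_cnj)

lemma additive_character_0 [simp]: "additive_character q 0 = 1"
  by (simp add: additive_character_def)

lemma additive_character_dvd:
  assumes "q \<ge> 1" "int q dvd a"
  shows "additive_character q a = 1"
proof -
  obtain k where "a = int q * k" using assms(2) by auto
  then have "of_int a / of_nat q = (of_int k :: real)" using assms(1) by simp
  then show ?thesis by (simp add: additive_character_def)
qed

lemma additive_character_cong:
  assumes "q \<ge> 1" "[a = b] (mod int q)"
  shows "additive_character q a = additive_character q b"
proof -
  have "additive_character q a = additive_character q b * additive_character q (a - b)"
    by (simp flip: additive_character_add)
  then show ?thesis using additive_character_dvd[OF assms(1)] assms(2) by (simp add: cong_iff_dvd_diff)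
qed

lemma additive_character_power: "additive_character q h ^ n = additive_character q (h * int n)"
  by (simp add: additive_character_def DeMoivre mult_ac)

lemma norm_one_minus_cis: "cmod (1 - cis t) = 2 * \<bar>sin (t / 2)\<bar>"
proof -
  have "(cmod (1 - cis t))\<^sup>2 = (1 - cos t)\<^sup>2 + (sin t)\<^sup>2"
    by (simp add: cmod_power2)
  also have "\<dots> = 2 - 2 * cos t"
    using sin_cos_squared_add[of t] by (simp add: power2_eq_square algebra_simps)
  also have "cos t = 1 - 2 * (sin (t / 2))\<^sup>2"
    using cos_double_sin[of "t / 2"] by simp
  finally have "(cmod (1 - cis t))\<^sup>2 = (2 * \<bar>sin (t / 2)\<bar>)\<^sup>2"
    by (simp add: power_mult_distrib)
  then show ?thesis by (rule power2_eq_imp_eq) auto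
qed

text \<open>Concavity of the sine on [0, pi/2] puts it above its chord from 0 to pi/2.\<close>

lemma jordan_sin_ge:
  fixes y :: real
  assumes "0 \<le> y" "y \<le> pi / 2"
  shows "2 * y / pi \<le> sin y"
proof -
  have "convex_on {0..pi / 2} (\<lambda>x. - sin x)"
  proof (rule f''_ge0_imp_convex)
    fix x :: real assume x: "x \<in> {0..pi / 2}"
    show "((\<lambda>x. - sin x) has_real_derivative - cos x) (at x)"
      by (auto intro!: derivative_eq_intros)
    show "((\<lambda>x. - cos x) has_real_derivative sin x) (at x)"
      by (auto intro!: derivative_eq_intros)
    show "0 \<le> sin x" using x by (intro sin_ge_zero) auto
  qed simp
  then have "- sin ((1 - 2 * y / pi) * 0 + (2 * y / pi) * (pi / 2))
      \<le> (1 - 2 * y / pi) * (- sin 0) + (2 * y / pi) * (- sin (pi / 2))"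
    using assms convex_onD[of "{0..pi / 2}" "\<lambda>x. - sin x" "2 * y / pi" 0 "pi / 2"]
    by (simp add: divide_simps)
  then show ?thesis by simp
qed

text \<open>The norm is 2 sin (pi |h| / q), and 2 |h| <= q keeps the angle in the range of Jordan's
  inequality.\<close>

lemma norm_one_minus_additive_character_ge:
  assumes "q \<ge> 1" "2 * \<bar>h\<bar> \<le> int q"
  shows "4 * real_of_int \<bar>h\<bar> / real q \<le> cmod (1 - additive_character q h)"
proof -
  define y where "y = pi * (real_of_int \<bar>h\<bar> / real q)"
  have "2 * real_of_int \<bar>h\<bar> \<le> real q" using assms(2) by linarith
  then have "real_of_int \<bar>h\<bar> / real q \<le> 1 / 2" using assms(1) by (simp add: divide_simps)
  then have "y \<le> pi * (1 / 2)" unfolding y_def by (intro mult_left_mono) auto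
  then have y: "0 \<le> y" "y \<le> pi / 2" by (auto simp: y_def)
  have "0 \<le> sin y" using y pi_gt_zero by (intro sin_ge_zero) linarith+
  have "\<bar>sin (2 * pi * (real_of_int h / real q) / 2)\<bar> = sin y"
  proof (cases "h \<ge> 0")
    case True
    then show ?thesis using \<open>0 \<le> sin y\<close> by (simp add: y_def)
  next
    case False
    then have "y = - (2 * pi * (real_of_int h / real q) / 2)" by (simp add: y_def)
    then show ?thesis using \<open>0 \<le> sin y\<close> by simp
  qed
  then have "cmod (1 - additive_character q h) = 2 * sin y"
    by (simp add: additive_character_def norm_one_minus_cis)
  moreover have "2 * y / pi = 2 * (real_of_int \<bar>h\<bar> / real q)" by (simp add: y_def)
  ultimately show ?thesis using jordan_sin_ge[OF y] by simp
qed

lemma norm_sum_additive_character_le_card: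
  "cmod (\<Sum>n=1..N. additive_character q (h * int n)) \<le> real N"
  by (rule order_trans[OF norm_sum]) simp

text \<open>Multiplying the geometric sum by 1 - z telescopes it to a difference of two numbers of
  norm 1; the lower bound for 1 - z does the rest.\<close>

lemma norm_sum_additive_character_le:
  assumes "q \<ge> 1" "h \<noteq> 0" "2 * \<bar>h\<bar> \<le> int q"
  shows "cmod (\<Sum>n=1..N. additive_character q (h * int n)) \<le> real q / (2 * real_of_int \<bar>h\<bar>)"
proof -
  define z where "z = additive_character q h"
  have h: "real_of_int \<bar>h\<bar> > 0" using assms(2) by simp
  have pos: "4 * real_of_int \<bar>h\<bar> / real q > 0" using h assms(1) by simp
  have ge: "4 * real_of_int \<bar>h\<bar> / real q \<le> cmod (1 - z)"
    unfolding z_def by (rule norm_one_minus_additive_character_ge[OF assms(1,3)])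
  have "(1 - z) * (\<Sum>n=1..N. z ^ n) = z - z ^ Suc N"
  proof (induction N)
    case (Suc N)
    have "(1 - z) * (\<Sum>n=1..Suc N. z ^ n) = (1 - z) * (\<Sum>n=1..N. z ^ n) + (1 - z) * z ^ Suc N"
      by (simp add: distrib_left)
    also have "\<dots> = z - z ^ Suc (Suc N)" unfolding Suc.IH by (simp add: algebra_simps)
    finally show ?case .
  qed simp
  then have "cmod (1 - z) * cmod (\<Sum>n=1..N. z ^ n) = cmod (z - z ^ Suc N)"
    by (metis norm_mult)
  also have "\<dots> \<le> cmod z + cmod (z ^ Suc N)" by (rule norm_triangle_ineq4)
  also have "\<dots> = 2" by (simp add: z_def norm_mult norm_power)
  finally have "cmod (1 - z) * cmod (\<Sum>n=1..N. z ^ n) \<le> 2" .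
  moreover have "4 * real_of_int \<bar>h\<bar> / real q * cmod (\<Sum>n=1..N. z ^ n) \<le> cmod (1 - z) * cmod (\<Sum>n=1..N. z ^ n)"
    using ge by (intro mult_right_mono) auto
  ultimately have "4 * real_of_int \<bar>h\<bar> / real q * cmod (\<Sum>n=1..N. z ^ n) \<le> 2" by linarith
  then have "cmod (\<Sum>n=1..N. z ^ n) \<le> 2 / (4 * real_of_int \<bar>h\<bar> / real q)"
    by (subst pos_le_divide_eq[OF pos]) (simp only: mult.commute)
  then show ?thesis by (simp add: z_def additive_character_power)
qed

text \<open>An arbitrary system of representatives, since Parseval is used over (0, q] and the
  Fourier expansion over (-q/2, q/2].\<close>

definition complete_residues :: "nat \<Rightarrow> int set \<Rightarrow> bool" where
  "complete_residues q S \<longleftrightarrow> bij_betw (\<lambda>h. h mod int q) S {0..<int q}"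

lemma sum_complete_residues:
  assumes "complete_residues q S" "\<And>a. f (a mod int q) = f a"
  shows "sum f S = sum f {0..<int q}"
  using sum.reindex_bij_betw[of "\<lambda>h. h mod int q" S "{0..<int q}" f] assms
  by (simp add: complete_residues_def)

lemma sum_additive_character:
  assumes "q \<ge> 1" "complete_residues q S"
  shows "(\<Sum>h\<in>S. additive_character q (h * k)) = (if int q dvd k then of_nat q else 0)"
proof -
  have "(\<Sum>h\<in>S. additive_character q (h * k)) = (\<Sum>h\<in>{0..<int q}. additive_character q (h * k))"
    by (rule sum_complete_residues[OF assms(2)])
      (auto intro!: additive_character_cong[OF assms(1)] cong_scalar_right simp: cong_def)
  also have "\<dots> = (\<Sum>n<q. additive_character q (int n * k))"
    by (rule sum.reindex_bij_witness[of _ int nat]) auto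
  also have "\<dots> = (\<Sum>n<q. additive_character q k ^ n)"
    by (simp add: additive_character_power mult.commute)
  also have "\<dots> = (if int q dvd k then of_nat q else 0)"
  proof (cases "int q dvd k")
    case True
    then show ?thesis by (simp add: additive_character_dvd[OF assms(1)])
  next
    case False
    \<comment> \<open>The least absolute residue of k meets the size condition of the lower bound,
      which shows that the ratio of the geometric sum is a q-th root of unity other than 1.\<close>
    define k' where "k' = (if 2 * (k mod int q) \<le> int q then k mod int q else k mod int q - int q)"
    have kc: "[k = k'] (mod int q)" by (auto simp: k'_def cong_def)
    have "0 \<le> k mod int q" "k mod int q < int q" using assms(1) by auto
    then have "2 * \<bar>k'\<bar> \<le> int q" by (auto simp: k'_def)
    moreover have "k' \<noteq> 0" using kc False by (auto simp: cong_0_iff)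
    ultimately have "0 < cmod (1 - additive_character q k')"
      using norm_one_minus_additive_character_ge[OF assms(1), of k'] assms(1)
      by (smt (verit) divide_pos_pos of_int_0_less_iff of_nat_0_less_iff of_nat_1 of_nat_le_iff zero_less_abs_iff)
    then have "additive_character q k \<noteq> 1"
      using additive_character_cong[OF assms(1) kc] by auto
    moreover have "additive_character q k ^ q = 1"
      by (simp add: additive_character_power additive_character_dvd[OF assms(1)])
    ultimately show ?thesis using False by (simp add: sum_gp_strict)
  qed
  finally show ?thesis .
qed

text \<open>The minus sign makes this the discrete Fourier transform of \<chi>, so that the
  inversion formula carries the plus sign.\<close>

definition gauss_sum :: "nat \<Rightarrow> (int \<Rightarrow> complex) \<Rightarrow> int \<Rightarrow> complex" where
  "gauss_sum q \<chi> h = (\<Sum>a\<in>residues_coprime q. \<chi> a * additive_character q (- (h * a)))"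

text \<open>After interchanging the sums, orthogonality of the additive characters selects a = n mod
  q. If n is not a unit, no a is selected and \<chi> n is 0 as well.\<close>

lemma gauss_sum_inversion:
  assumes "q \<ge> 1" "complete_residues q S" and \<chi>: "dirichlet_character q \<chi>"
  shows "(\<Sum>h\<in>S. gauss_sum q \<chi> h * additive_character q (h * n)) = of_nat q * \<chi> n"
proof -
  have "(\<Sum>h\<in>S. gauss_sum q \<chi> h * additive_character q (h * n))
      = (\<Sum>h\<in>S. \<Sum>a\<in>residues_coprime q. \<chi> a * additive_character q (h * (n - a)))"
    by (simp add: gauss_sum_def sum_distrib_right mult.assoc right_diff_distrib
        flip: additive_character_add)
  also have "\<dots> = (\<Sum>a\<in>residues_coprime q. \<chi> a * (\<Sum>h\<in>S. additive_character q (h * (n - a))))"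
    by (subst sum.swap) (simp add: sum_distrib_left)
  also have "\<dots> = (\<Sum>a\<in>residues_coprime q. if a = n mod int q then of_nat q * \<chi> n else 0)"
  proof (intro sum.cong refl)
    fix a assume a: "a \<in> residues_coprime q"
    have "int q dvd n - a \<longleftrightarrow> a = n mod int q"
      using a by (auto simp: residues_coprime_def mod_eq_dvd_iff[symmetric])
    moreover have "\<chi> (n mod int q) = \<chi> n" by (rule dirichlet_character_mod[OF \<chi>])
    ultimately show "\<chi> a * (\<Sum>h\<in>S. additive_character q (h * (n - a)))
        = (if a = n mod int q then of_nat q * \<chi> n else 0)"
      unfolding sum_additive_character[OF assms(1,2)] by auto
  qed
  also have "\<dots> = of_nat q * \<chi> n"
  proof (cases "coprime n (int q)")
    case True
    then have "n mod int q \<in> residues_coprime q" using assms(1) by (simp add: residues_coprime_def)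
    then show ?thesis by simp
  next
    case False
    then show ?thesis using dirichlet_character_eq_0_iff[OF \<chi>, of n] by simp
  qed
  finally show ?thesis .
qed

text \<open>At frequency 0 the Gauss sum is the inner product with the principal character. This is
  how non-principality removes the main term of the Fourier expansion.\<close>

lemma gauss_sum_0:
  assumes "q \<ge> 1" "dirichlet_character q \<chi>" "\<chi> \<noteq> principal_character q"
  shows "gauss_sum q \<chi> 0 = 0"
proof -
  have "(\<Sum>a\<in>residues_coprime q. \<chi> a * cnj (principal_character q a)) = 0"
    using sum_dirichlet_character_mult_cnj_eq_0[OF assms(2) dirichlet_character_principal assms(3,1)] .
  moreover have "(\<Sum>a\<in>residues_coprime q. \<chi> a * cnj (principal_character q a)) = gauss_sum q \<chi> 0"
    unfolding gauss_sum_def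
    by (intro sum.cong) (auto simp: principal_character_def residues_coprime_def)
  ultimately show ?thesis by simp
qed

lemma gauss_sum_cong:
  assumes "q \<ge> 1" "[h = h'] (mod int q)"
  shows "gauss_sum q \<chi> h = gauss_sum q \<chi> h'"
  unfolding gauss_sum_def
  by (intro sum.cong refl arg_cong2[where f = "(*)"] additive_character_cong[OF assms(1)]
      cong_minus_minus_iff[THEN iffD2] cong_scalar_right assms(2))

text \<open>Substitute w a for a. With h w congruent to gcd h q, the frequency enters only through
  the factor \<chi> w and the gcd.\<close>

lemma gauss_sum_mult:
  assumes "q \<ge> 1" and \<chi>: "dirichlet_character q \<chi>" and w: "coprime w (int q)"
  shows "gauss_sum q \<chi> h = \<chi> w * gauss_sum q \<chi> (h * w)"
proof -
  have "gauss_sum q \<chi> h = (\<Sum>a\<in>residues_coprime q. \<chi> (w * a) * additive_character q (- (h * (w * a))))"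
    unfolding gauss_sum_def
  proof (rule sum_residues_coprime_mult[OF assms(1) w, symmetric])
    fix a
    have "[- (h * (a mod int q)) = - (h * a)] (mod int q)"
      by (intro cong_minus_minus_iff[THEN iffD2] cong_scalar_left) (simp add: cong_def)
    then show "\<chi> (a mod int q) * additive_character q (- (h * (a mod int q)))
        = \<chi> a * additive_character q (- (h * a))"
      by (simp add: dirichlet_character_mod[OF \<chi>] additive_character_cong[OF assms(1)])
  qed
  then show ?thesis
    by (simp add: gauss_sum_def dirichlet_character_mult[OF \<chi>] sum_distrib_left mult.assoc)
qed

text \<open>Expand one conjugated Gauss sum and apply the inversion formula to the other.\<close>

lemma gauss_sum_parseval:
  assumes "q \<ge> 1" "complete_residues q S" and \<chi>: "dirichlet_character q \<chi>"
  shows "(\<Sum>h\<in>S. (cmod (gauss_sum q \<chi> h))\<^sup>2) = real q * real (totient q)"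
proof -
  let ?G = "residues_coprime q"
  have "of_real (\<Sum>h\<in>S. (cmod (gauss_sum q \<chi> h))\<^sup>2) = (\<Sum>h\<in>S. gauss_sum q \<chi> h * cnj (gauss_sum q \<chi> h))"
    unfolding of_real_sum complex_norm_square ..
  also have "\<dots> = (\<Sum>h\<in>S. \<Sum>a\<in>?G. gauss_sum q \<chi> h * additive_character q (h * a) * cnj (\<chi> a))"
  proof (intro sum.cong refl)
    fix h
    have "cnj (gauss_sum q \<chi> h) = (\<Sum>a\<in>?G. additive_character q (h * a) * cnj (\<chi> a))"
      by (simp add: gauss_sum_def cnj_additive_character mult.commute)
    then show "gauss_sum q \<chi> h * cnj (gauss_sum q \<chi> h)
        = (\<Sum>a\<in>?G. gauss_sum q \<chi> h * additive_character q (h * a) * cnj (\<chi> a))"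
      by (simp only: sum_distrib_left mult.assoc)
  qed
  also have "\<dots> = (\<Sum>a\<in>?G. (\<Sum>h\<in>S. gauss_sum q \<chi> h * additive_character q (h * a)) * cnj (\<chi> a))"
    by (subst sum.swap) (simp only: sum_distrib_right)
  also have "\<dots> = of_nat q * (\<Sum>a\<in>?G. \<chi> a * cnj (\<chi> a))"
    unfolding gauss_sum_inversion[OF assms] by (simp only: sum_distrib_left mult.assoc)
  also have "\<dots> = of_nat q * of_nat (totient q)"
    by (simp only: sum_dirichlet_character_mult_cnj_self[OF \<chi> assms(1)])
  also have "\<dots> = of_real (real q * real (totient q))" by simp
  finally show ?thesis by (simp only: of_real_eq_iff)
qed

text \<open>Take b = a + r k with k the product of the primes that divide q but not a. A prime
  divisor of q that divides a divides neither r nor k; one that does not divide a divides k. In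
  neither case does it divide b.\<close>

lemma coprime_lift:
  fixes a :: int
  assumes "q \<ge> 1" "r dvd int q" "coprime a r"
  obtains b where "coprime b (int q)" "[b = a] (mod r)"
proof
  define P where "P = {p. prime p \<and> p dvd int q \<and> \<not> p dvd a}"
  have finP: "finite P"
    by (rule finite_subset[of _ "{p. p dvd int q}"]) (use assms(1) in \<open>auto simp: P_def\<close>)
  define k where "k = \<Prod>P"
  show "[a + r * k = a] (mod r)" by (simp add: cong_def)
  show "coprime (a + r * k) (int q)"
  proof (rule ccontr)
    assume "\<not> coprime (a + r * k) (int q)"
    then have "\<not> is_unit (gcd (a + r * k) (int q))" by (simp add: coprime_iff_gcd_eq_1)
    moreover have "gcd (a + r * k) (int q) \<noteq> 0" using assms(1) by simp
    ultimately obtain p where p: "prime p" "p dvd gcd (a + r * k) (int q)"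
      using prime_divisorE by blast
    then have p1: "p dvd a + r * k" and p2: "p dvd int q" by auto
    show False
    proof (cases "p dvd a")
      case True
      then have "p dvd r * k" using p1 by (simp add: dvd_add_right_iff)
      then consider "p dvd r" | "p dvd k" using p(1) prime_dvd_mult_iff by blast
      then show False
      proof cases
        case 1
        then show False using True assms(3) p(1) by (meson coprime_def not_prime_unit)
      next
        case 2
        then obtain p' where "p' \<in> P" "p dvd p'"
          unfolding k_def using prime_dvd_prod_iff[OF finP p(1), of "\<lambda>x. x"] by auto
        then have "p' = p" using p(1) by (auto simp: P_def dest: primes_dvd_imp_eq)
        then show False using True \<open>p' \<in> P\<close> by (simp add: P_def)
      qed
    next
      case False
      then have "p \<in> P" using p(1) p2 by (simp add: P_def)
      then have "p dvd r * k" unfolding k_def using finP by (intro dvd_mult dvd_prodI)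
      then show False using p1 False by (simp add: dvd_add_left_iff)
    qed
  qed
qed

text \<open>Write h = g u and q = g r. An inverse of u modulo r lifts to a unit w modulo q, and u w
  = 1 modulo r, multiplied by g, is the claim.\<close>

lemma exists_coprime_mult_cong_gcd:
  fixes h :: int
  assumes "q \<ge> 1"
  obtains w where "coprime w (int q)" "[h * w = gcd h (int q)] (mod int q)"
proof -
  define g where "g = gcd h (int q)"
  have g: "g > 0" using assms by (simp add: g_def)
  define u r where "u = h div g" and "r = int q div g"
  have h: "h = g * u" and q: "int q = g * r" by (simp_all add: u_def r_def g_def)
  have "coprime u r" unfolding u_def r_def g_def using assms by (intro div_gcd_coprime) auto
  then obtain x where x: "[u * x = 1] (mod r)" using cong_solve_coprime_int by blast
  then have "coprime (u * x) r" using cong_imp_coprime[OF cong_sym[OF x]] by simp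
  then have "coprime x r" by simp
  then obtain w where w: "coprime w (int q)" "[w = x] (mod r)"
    using coprime_lift[OF assms, of r x] q by auto
  have "[u * w = 1] (mod r)" using cong_trans[OF cong_scalar_left[OF w(2)] x] .
  then have "r dvd u * w - 1" by (simp add: cong_iff_dvd_diff)
  then have "g * r dvd g * (u * w - 1)" by simp
  then have "[h * w = g] (mod int q)" by (simp add: cong_iff_dvd_diff h q right_diff_distrib mult.assoc)
  then show thesis using that w(1) by (simp add: g_def)
qed

text \<open>In the product formula the prime factors of r are among those of g r, and each
  additional factor 1 - 1/p is at most 1.\<close>

lemma totient_mult_le:
  assumes "g \<ge> 1" "r \<ge> 1"
  shows "totient (g * r) \<le> g * totient r"
proof -
  have "(\<Prod>p\<in>prime_factors (g * r). 1 - 1 / real p) \<le> (\<Prod>p\<in>prime_factors r. 1 - 1 / real p)"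
  proof -
    have 1: "0 \<le> 1 - 1 / real p" "1 - 1 / real p \<le> 1" if "p \<in> prime_factors (g * r)" for p
      using that prime_gt_0_nat[of p] by (auto simp: in_prime_factors_iff)
    have sub: "prime_factors r \<subseteq> prime_factors (g * r)"
      using assms by (intro dvd_prime_factors) auto
    have "(\<Prod>p\<in>prime_factors (g * r). 1 - 1 / real p)
        = (\<Prod>p\<in>prime_factors (g * r) - prime_factors r. 1 - 1 / real p) * (\<Prod>p\<in>prime_factors r. 1 - 1 / real p)"
      by (rule prod.subset_diff[OF sub]) simp
    also have "\<dots> \<le> 1 * (\<Prod>p\<in>prime_factors r. 1 - 1 / real p)"
      using 1 sub by (intro mult_right_mono prod_le_1 prod_nonneg) auto
    finally show ?thesis by simp
  qed
  then have "real (g * r) * (\<Prod>p\<in>prime_factors (g * r). 1 - 1 / real p)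
      \<le> real (g * r) * (\<Prod>p\<in>prime_factors r. 1 - 1 / real p)"
    by (rule mult_left_mono) simp
  then have "real (totient (g * r)) \<le> real g * real (totient r)"
    by (simp only: totient_formula2 of_nat_mult mult.assoc)
  then show ?thesis by (simp only: of_nat_mult[symmetric] of_nat_le_iff)
qed

text \<open>All \<open>totient r\<close> frequencies with gcd g, where r = q / g, give Gauss sums of
  the same norm. Parseval bounds their total by q times \<open>totient q\<close>, and
  \<open>totient q\<close> is at most g times \<open>totient r\<close>. Imprimitive characters are
  covered.\<close>

lemma norm_gauss_sum_dvd_le:
  assumes "q \<ge> 1" and \<chi>: "dirichlet_character q \<chi>" and "g dvd q"
  shows "(cmod (gauss_sum q \<chi> (int g)))\<^sup>2 \<le> real q * real g"
proof -
  define r where "r = q div g"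
  have q: "q = g * r" using assms(3) by (simp add: r_def)
  have g: "g \<ge> 1" and r: "r \<ge> 1" using q assms(1) by (auto simp: Suc_le_eq intro: Nat.gr0I)
  \<comment> \<open>The range (0, q] is the one in which \<open>card_gcd_eq_totient\<close>
    counts.\<close>
  define S where "S = int ` {0<..q}"
  have "complete_residues q S"
    unfolding complete_residues_def S_def
  proof (rule bij_betwI[where g = "\<lambda>a. if a = 0 then int q else a"])
    show "(\<lambda>h. h mod int q) \<in> int ` {0<..q} \<rightarrow> {0..<int q}" using assms(1) by auto
    show "(\<lambda>a. if a = 0 then int q else a) \<in> {0..<int q} \<rightarrow> int ` {0<..q}"
    proof
      fix a assume "a \<in> {0..<int q}"
      then show "(if a = 0 then int q else a) \<in> int ` {0<..q}"
        using assms(1) image_eqI[of a int "nat a" "{0<..q}"] by auto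
    qed
    fix x assume "x \<in> int ` {0<..q}"
    then obtain n where "x = int n" "0 < n" "n \<le> q" by auto
    then show "(if x mod int q = 0 then int q else x mod int q) = x"
      by (cases "n = q") auto
  qed auto
  then have pars: "(\<Sum>h\<in>S. (cmod (gauss_sum q \<chi> h))\<^sup>2) = real q * real (totient q)"
    by (rule gauss_sum_parseval[OF assms(1) _ \<chi>])
  let ?A = "{k \<in> {0<..q}. gcd k q = g}"
  have "real (totient r) * (cmod (gauss_sum q \<chi> (int g)))\<^sup>2 = (\<Sum>k\<in>?A. (cmod (gauss_sum q \<chi> (int g)))\<^sup>2)"
    using card_gcd_eq_totient[of q g] assms(1,3) by (simp add: r_def)
  also have "\<dots> = (\<Sum>k\<in>?A. (cmod (gauss_sum q \<chi> (int k)))\<^sup>2)"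
  proof (intro sum.cong refl)
    fix k assume k: "k \<in> ?A"
    obtain w where w: "coprime w (int q)" "[int k * w = gcd (int k) (int q)] (mod int q)"
      using exists_coprime_mult_cong_gcd[OF assms(1)] by blast
    have "gcd (int k) (int q) = int g" using k by auto
    then have "gauss_sum q \<chi> (int k) = \<chi> w * gauss_sum q \<chi> (int g)"
      using gauss_sum_mult[OF assms(1) \<chi> w(1), of "int k"] gauss_sum_cong[OF assms(1) w(2), of \<chi>] by simp
    then show "(cmod (gauss_sum q \<chi> (int g)))\<^sup>2 = (cmod (gauss_sum q \<chi> (int k)))\<^sup>2"
      by (simp add: norm_mult norm_dirichlet_character[OF \<chi> assms(1) w(1)])
  qed
  also have "\<dots> \<le> (\<Sum>k\<in>{0<..q}. (cmod (gauss_sum q \<chi> (int k)))\<^sup>2)"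
    by (intro sum_mono2) auto
  also have "\<dots> = real q * real (totient q)"
    using pars by (simp add: S_def sum.reindex)
  also have "\<dots> \<le> real q * real (g * totient r)"
    using totient_mult_le[OF g r] q by (intro mult_left_mono) (auto simp del: of_nat_mult)
  finally have "real (totient r) * (cmod (gauss_sum q \<chi> (int g)))\<^sup>2 \<le> real (totient r) * (real q * real g)"
    by (simp add: mult_ac)
  moreover have "real (totient r) > 0" using r by simp
  ultimately show ?thesis by (simp only: mult_le_cancel_left_pos)
qed

section \<open>Mean squares of character sums\<close>

text \<open>The interval (-q/2, q/2], so that every frequency satisfies the size condition of the
  exponential sum bound.\<close>

definition centred_residues :: "nat \<Rightarrow> int set" where
  "centred_residues q = {h. - int q < 2 * h \<and> 2 * h \<le> int q}"

lemma complete_centred_residues: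
  assumes "q \<ge> 1"
  shows "complete_residues q (centred_residues q)"
  unfolding complete_residues_def
proof (rule bij_betwI[where g = "\<lambda>a. if 2 * a \<le> int q then a else a - int q"])
  fix x assume x: "x \<in> centred_residues q"
  have "x mod int q = (if 0 \<le> x then x else x + int q)"
  proof (cases "0 \<le> x")
    case True
    then show ?thesis using x assms by (auto simp: centred_residues_def)
  next
    case False
    have "x mod int q = (x + int q) mod int q" by simp
    also have "\<dots> = x + int q" using x False by (intro mod_pos_pos_trivial) (auto simp: centred_residues_def)
    finally show ?thesis using False by simp
  qed
  then show "(if 2 * (x mod int q) \<le> int q then x mod int q else x mod int q - int q) = x"
    using x by (auto simp: centred_residues_def)
next
  fix y assume "y \<in> {0..<int q}"
  then show "(if 2 * y \<le> int q then y else y - int q) mod int q = y"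
    by auto
qed (use assms in \<open>auto simp: centred_residues_def\<close>)

lemma finite_centred_residues [simp]: "finite (centred_residues q)"
  by (rule finite_subset[of _ "{- int q..int q}"]) (auto simp: centred_residues_def)

text \<open>Optimization in the dual range. Both terms use A H <= r: the first is A (A H) with A <=
  min M q, the second is (A H)^2 / sqrt r <= r sqrt r with sqrt r <= min M q, where q <= M^2
  enters.\<close>

lemma mult_add_square_div_sqrt_le:
  fixes A H r q M :: real
  assumes "0 \<le> A" "A \<le> M" "A \<le> r / H" "1 \<le> H" "1 \<le> r" "r \<le> q" "q \<le> M\<^sup>2" "1 \<le> M"
  shows "A\<^sup>2 * (H + H\<^sup>2 / sqrt r) \<le> 2 * r * min M q"
proof -
  have AH: "A * H \<le> r" using assms(3,4) by (simp add: pos_le_divide_eq)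
  have "A \<le> q"
  proof -
    have "r / H \<le> r" using assms(4,5) by (simp add: divide_le_eq)
    then show ?thesis using assms by linarith
  qed
  then have "A * (A * H) \<le> min M q * r"
    using AH assms by (intro mult_mono) auto
  then have 1: "A\<^sup>2 * H \<le> r * min M q" by (simp add: power2_eq_square mult_ac)
  have "sqrt r \<le> min M q"
  proof -
    have "sqrt r \<le> sqrt q" using assms by simp
    moreover have "sqrt q \<le> M" using assms by (intro real_le_lsqrt) auto
    moreover have "sqrt q \<le> q" using assms
      by (intro real_le_lsqrt) (auto simp: power2_eq_square mult_le_cancel_right1)
    ultimately show ?thesis by linarith
  qed
  have "A\<^sup>2 * (H\<^sup>2 / sqrt r) = (A * H)\<^sup>2 / sqrt r" by (simp add: power_mult_distrib)
  also have "\<dots> \<le> r\<^sup>2 / sqrt r"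
    using AH assms by (intro divide_right_mono power_mono) auto
  also have "\<dots> = r * sqrt r"
    using assms by (simp add: power2_eq_square divide_eq_eq mult.assoc)
  also have "\<dots> \<le> r * min M q" using \<open>sqrt r \<le> min M q\<close> assms by (intro mult_left_mono) auto
  finally have "A\<^sup>2 * (H\<^sup>2 / sqrt r) \<le> r * min M q" .
  with 1 show ?thesis by (simp add: distrib_left)
qed

text \<open>Puts the counting bounds into the squared form that the bilinear estimate takes.\<close>

lemma add_square_le_square_add_sqrt:
  fixes H r c :: real
  assumes "0 \<le> H" "0 < r" "0 \<le> c"
  shows "c\<^sup>2 * (H\<^sup>2 + H ^ 4 / r) \<le> (c * (H + H\<^sup>2 / sqrt r))\<^sup>2"
proof -
  have "H\<^sup>2 + H ^ 4 / r = H\<^sup>2 + (H\<^sup>2 / sqrt r)\<^sup>2"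
    using assms by (simp add: power_divide)
  also have "\<dots> \<le> (H + H\<^sup>2 / sqrt r)\<^sup>2" using assms by (simp add: power2_sum)
  finally show ?thesis by (simp add: power_mult_distrib mult_left_mono)
qed

section \<open>One block: the dual range, the direct range and their union\<close>

lemma ex_dyadic_interval:
  fixes u :: int
  assumes "u \<noteq> 0"
  obtains k where "2 ^ k \<le> \<bar>u\<bar>" "\<bar>u\<bar> < 2 ^ (k + 1)"
proof -
  have "1 \<le> nat \<bar>u\<bar>" using assms by simp
  then obtain k where k: "2 ^ k \<le> nat \<bar>u\<bar>" "nat \<bar>u\<bar> < 2 ^ (k + 1)"
    using ex_power_ivl1[of 2 "nat \<bar>u\<bar>"] by auto
  have "2 ^ k \<le> \<bar>u\<bar>" "\<bar>u\<bar> < 2 ^ (k + 1)"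
    using k by (auto simp: nat_less_iff le_nat_iff)
  then show thesis by (rule that)
qed

text \<open>The range q <= M^2. After Fourier expansion of the inner sums the nonzero frequencies
  fall into \<tau>(q) L boxes, on each of which the Gauss sum is constant up to \<chi>(w) and the
  bilinear estimate applies. Cauchy--Schwarz over the boxes costs the square of their
  number.\<close>

lemma dual_mean_square_le:
  fixes D :: "int set" and b :: "int \<Rightarrow> complex" and N :: "int \<Rightarrow> nat"
  assumes q: "q \<ge> 1" and D: "finite D" "\<And>d. d \<in> D \<Longrightarrow> coprime d (int q)"
    and b: "\<And>d. d \<in> D \<Longrightarrow> cmod (b d) \<le> 1" and N: "\<And>d. d \<in> D \<Longrightarrow> N d \<le> M"
    and M: "M \<ge> 1" "real q \<le> (real M)\<^sup>2"
    and T: "\<And>n. 1 \<le> n \<Longrightarrow> n \<le> q\<^sup>2 \<Longrightarrow> card {d. d dvd n} \<le> T"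
    and ED: "real (card {(p, p'). p \<in> D \<times> D \<and> p' \<in> D \<times> D \<and>
          [(fst p * snd p)\<^sup>2 = (fst p' * snd p')\<^sup>2] (mod int q)}) \<le> e\<^sub>D\<^sup>2" and "e\<^sub>D \<ge> 0"
    and L: "q < 2 ^ L"
  shows "(\<Sum>\<chi> | dirichlet_character q \<chi> \<and> \<chi> \<noteq> principal_character q.
      (cmod (\<Sum>d\<in>D. b d * \<chi> (d\<^sup>2) * (\<Sum>n=1..N d. \<chi> (int n))))\<^sup>2)
    \<le> real (totient q) * ((real (card {d. d dvd q}) * real L)\<^sup>2 * (8 * real T * min (real M) (real q) * e\<^sub>D))"
proof -
  define X where "X = {\<chi>. dirichlet_character q \<chi> \<and> \<chi> \<noteq> principal_character q}"
  have X: "X \<subseteq> {\<chi>. dirichlet_character q \<chi>}" by (auto simp: X_def)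
  define S where "S = centred_residues q"
  have S: "complete_residues q S" unfolding S_def by (rule complete_centred_residues[OF q])
  have finS: "finite S" by (simp add: S_def)
  define C where "C h n = (\<Sum>m=1..n. additive_character q (h * int m))" for h n
  have "\<forall>h. \<exists>w. coprime w (int q) \<and> [h * w = gcd h (int q)] (mod int q)"
    using exists_coprime_mult_cong_gcd[OF q] by metis
  then obtain w where w: "\<And>h. coprime (w h) (int q)" "\<And>h. [h * w h = gcd h (int q)] (mod int q)"
    by metis
  define \<gamma> where "\<gamma> h = nat (gcd h (int q))" for h
  have \<gamma>: "int (\<gamma> h) = gcd h (int q)" for h by (simp add: \<gamma>_def)
  have \<gamma>q: "\<gamma> h dvd q" for h
  proof -
    have "int (\<gamma> h) dvd int q" unfolding \<gamma> by simp
    then show ?thesis by simp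
  qed
  have \<gamma>h: "int (\<gamma> h) dvd h" for h unfolding \<gamma> by simp
  have \<gamma>1: "\<gamma> h \<ge> 1" for h using \<gamma>q[of h] q by (cases "\<gamma> h") auto
  have "\<forall>h. h \<noteq> 0 \<longrightarrow> (\<exists>k. 2 ^ k * int (\<gamma> h) \<le> \<bar>h\<bar> \<and> \<bar>h\<bar> < 2 ^ (k + 1) * int (\<gamma> h))"
  proof (intro allI impI)
    fix h :: int assume "h \<noteq> 0"
    obtain u where u: "h = int (\<gamma> h) * u" using \<gamma>h[of h] by auto
    have habs: "\<bar>h\<bar> = \<bar>u\<bar> * int (\<gamma> h)"
      using arg_cong[OF u, of abs] by (simp only: abs_mult abs_of_nat mult.commute)
    have "u \<noteq> 0" using \<open>h \<noteq> 0\<close> u by (metis mult_zero_right)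
    then obtain k where "2 ^ k \<le> \<bar>u\<bar>" "\<bar>u\<bar> < 2 ^ (k + 1)" by (rule ex_dyadic_interval)
    then have "2 ^ k * int (\<gamma> h) \<le> \<bar>h\<bar> \<and> \<bar>h\<bar> < 2 ^ (k + 1) * int (\<gamma> h)"
      unfolding habs using \<gamma>1[of h] by (intro conjI mult_right_mono mult_strict_right_mono) auto
    then show "\<exists>k. 2 ^ k * int (\<gamma> h) \<le> \<bar>h\<bar> \<and> \<bar>h\<bar> < 2 ^ (k + 1) * int (\<gamma> h)" by blast
  qed
  then obtain \<kappa> where \<kappa>: "\<And>h. h \<noteq> 0 \<Longrightarrow> 2 ^ \<kappa> h * int (\<gamma> h) \<le> \<bar>h\<bar>"
      "\<And>h. h \<noteq> 0 \<Longrightarrow> \<bar>h\<bar> < 2 ^ (\<kappa> h + 1) * int (\<gamma> h)"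
    by metis
  \<comment> \<open>Frequencies are grouped by \<open>g = gcd h q\<close> and by the dyadic size of \<open>h / g\<close>.\<close>
  define I where "I = {g. g dvd q} \<times> {..<L}"
  have finI: "finite I" using q by (simp add: I_def)
  have cardI: "real (card I) = real (card {d. d dvd q}) * real L"
    by (simp add: I_def card_cartesian_product)
  define U where "U i = {h. h \<in> S - {0} \<and> (\<gamma> h, \<kappa> h) = i}" for i
  have finU: "finite (U i)" for i using finS by (simp add: U_def)
  have half: "2 * \<bar>h\<bar> \<le> int q" if "h \<in> S" for h
    using that by (auto simp: S_def centred_residues_def)
  have inI: "(\<gamma> h, \<kappa> h) \<in> I" if h: "h \<in> S - {0}" for h
  proof -
    have "(2::int) ^ \<kappa> h * 1 \<le> 2 ^ \<kappa> h * int (\<gamma> h)" using \<gamma>1[of h] by (intro mult_left_mono) auto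
    also have "\<dots> \<le> \<bar>h\<bar>" using \<kappa>(1) h by auto
    also have "\<dots> < 2 ^ L"
    proof -
      have "int q < int (2 ^ L)" using L by (simp only: of_nat_less_iff)
      then have "int q < 2 ^ L" by simp
      moreover have "2 * \<bar>h\<bar> \<le> int q" using half h by blast
      ultimately show ?thesis by linarith
    qed
    finally have "\<kappa> h < L" by simp
    then show ?thesis using \<gamma>q by (simp add: I_def)
  qed
  \<comment> \<open>\<open>C h (N d)\<close> couples d and h but is free of \<chi>, so it is
    absorbed into the coefficient of the bilinear form.\<close>
  define W where "W i \<chi> = (\<Sum>d\<in>D. \<Sum>h\<in>U i. (b d * C h (N d)) * \<chi> (d\<^sup>2 * w h))" for i \<chi>
  define V where "V \<chi> = (\<Sum>d\<in>D. b d * \<chi> (d\<^sup>2) * (\<Sum>n=1..N d. \<chi> (int n)))" for \<chi> :: "int \<Rightarrow> complex"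
  have V_eq: "V \<chi> = (\<Sum>i\<in>I. gauss_sum q \<chi> (int (fst i)) / of_nat q * W i \<chi>)" if "\<chi> \<in> X" for \<chi>
  proof -
    have \<chi>: "dirichlet_character q \<chi>" and "\<chi> \<noteq> principal_character q" using that by (auto simp: X_def)
    have g0: "gauss_sum q \<chi> 0 = 0" by (rule gauss_sum_0[OF q]) fact+
    have sumchi: "of_nat q * (\<Sum>n=1..m. \<chi> (int n)) = (\<Sum>h\<in>S - {0}. gauss_sum q \<chi> h * C h m)" for m
    proof -
      have "of_nat q * (\<Sum>n=1..m. \<chi> (int n)) = (\<Sum>n=1..m. \<Sum>h\<in>S. gauss_sum q \<chi> h * additive_character q (h * int n))"
        by (simp only: gauss_sum_inversion[OF q S \<chi>] sum_distrib_left)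
      also have "\<dots> = (\<Sum>h\<in>S. gauss_sum q \<chi> h * C h m)"
        by (subst sum.swap) (simp only: C_def sum_distrib_left)
      also have "\<dots> = (\<Sum>h\<in>S - {0}. gauss_sum q \<chi> h * C h m)"
        using finS by (intro sum.mono_neutral_right) (auto simp: g0)
      finally show ?thesis .
    qed
    have gh: "gauss_sum q \<chi> h = \<chi> (w h) * gauss_sum q \<chi> (int (\<gamma> h))" for h
      using gauss_sum_mult[OF q \<chi> w(1), of h h] gauss_sum_cong[OF q w(2), of \<chi> h] by (simp add: \<gamma>)
    have "of_nat q * V \<chi> = (\<Sum>d\<in>D. b d * \<chi> (d\<^sup>2) * (of_nat q * (\<Sum>n=1..N d. \<chi> (int n))))"
      by (simp add: V_def sum_distrib_left mult_ac)
    also have "\<dots> = (\<Sum>d\<in>D. \<Sum>h\<in>S - {0}. gauss_sum q \<chi> (int (\<gamma> h)) * (b d * C h (N d) * \<chi> (d\<^sup>2 * w h)))"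
      unfolding sumchi unfolding sum_distrib_left
    proof (intro sum.cong refl)
      fix d h
      show "b d * \<chi> (d\<^sup>2) * (gauss_sum q \<chi> h * C h (N d))
          = gauss_sum q \<chi> (int (\<gamma> h)) * (b d * C h (N d) * \<chi> (d\<^sup>2 * w h))"
        by (simp only: gh[of h] dirichlet_character_mult[OF \<chi>] mult_ac)
    qed
    also have "\<dots> = (\<Sum>d\<in>D. \<Sum>i\<in>I. \<Sum>h\<in>U i. gauss_sum q \<chi> (int (\<gamma> h)) * (b d * C h (N d) * \<chi> (d\<^sup>2 * w h)))"
    proof (intro sum.cong refl)
      fix d
      show "(\<Sum>h\<in>S - {0}. gauss_sum q \<chi> (int (\<gamma> h)) * (b d * C h (N d) * \<chi> (d\<^sup>2 * w h)))
          = (\<Sum>i\<in>I. \<Sum>h\<in>U i. gauss_sum q \<chi> (int (\<gamma> h)) * (b d * C h (N d) * \<chi> (d\<^sup>2 * w h)))"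
        unfolding U_def using finS finI inI by (intro sum.group[symmetric]) auto
    qed
    also have "\<dots> = (\<Sum>d\<in>D. \<Sum>i\<in>I. gauss_sum q \<chi> (int (fst i)) * (\<Sum>h\<in>U i. b d * C h (N d) * \<chi> (d\<^sup>2 * w h)))"
      unfolding sum_distrib_left by (intro sum.cong refl) (auto simp: U_def)
    also have "\<dots> = (\<Sum>i\<in>I. gauss_sum q \<chi> (int (fst i)) * W i \<chi>)"
      by (subst sum.swap) (simp only: W_def sum_distrib_left)
    finally have "of_nat q * V \<chi> = (\<Sum>i\<in>I. gauss_sum q \<chi> (int (fst i)) * W i \<chi>)" .
    then have "V \<chi> = (\<Sum>i\<in>I. gauss_sum q \<chi> (int (fst i)) * W i \<chi>) / of_nat q"
      using q by (simp add: field_simps)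
    then show ?thesis by (simp add: sum_divide_distrib)
  qed
  have W_le: "(\<Sum>\<chi>\<in>X. (cmod (gauss_sum q \<chi> (int (fst i)) / of_nat q * W i \<chi>))\<^sup>2)
      \<le> real (totient q) * (8 * real T * min (real M) (real q) * e\<^sub>D)" if "i \<in> I" for i
  proof (cases "U i = {}")
    case True
    then show ?thesis using \<open>e\<^sub>D \<ge> 0\<close> by (simp add: W_def)
  next
    case False
    obtain g k where i: "i = (g, k)" by (cases i)
    then have gq: "g dvd q" using \<open>i \<in> I\<close> by (simp add: I_def)
    define r where "r = q div g"
    have qgr: "q = g * r" using gq by (simp add: r_def)
    have g1: "g \<ge> 1" and r1: "r \<ge> 1" using qgr q by (auto simp: Suc_le_eq intro: Nat.gr0I)
    define H where "H = (2::nat) ^ (k + 1)"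
    have H1: "H \<ge> 1" by (simp add: H_def)
    have Ui: "h \<in> S" "h \<noteq> 0" "int g dvd h" "int H * int g \<le> 2 * \<bar>h\<bar>" "\<bar>h\<bar> < int H * int g"
      "[h * w h = int g] (mod int q)" if "h \<in> U i" for h
      using that \<kappa>[of h] \<gamma>h[of h] w(2)[of h] by (auto simp: U_def i H_def \<gamma>[symmetric])
    \<comment> \<open>A member h of the box gives H g <= 2 |h| <= q = g r; an empty box gives no
      such relation and is treated apart.\<close>
    have Hr: "H \<le> r"
    proof -
      obtain h where h: "h \<in> U i" using False by blast
      have "int H * int g \<le> int r * int g" using Ui(1,4)[OF h] half[of h] qgr by (simp add: mult.commute)
      then show ?thesis using g1 by (simp add: mult_le_cancel_right)
    qed
    \<comment> \<open>The trivial bound for the exponential sum, and the geometric one: q / (2 |h|)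
      is at most q / (H g) = r / H.\<close>
    define A where "A = min (real M) (real r / real H)"
    have C_le: "cmod (b d * C h (N d)) \<le> A" if "d \<in> D" "h \<in> U i" for d h
    proof -
      have "cmod (C h (N d)) \<le> real (N d)" unfolding C_def by (rule norm_sum_additive_character_le_card)
      then have 1: "cmod (C h (N d)) \<le> real M" using N[OF \<open>d \<in> D\<close>] by linarith
      have "cmod (C h (N d)) \<le> real q / (2 * real_of_int \<bar>h\<bar>)"
        unfolding C_def using Ui(1,2)[OF that(2)] half[of h]
        by (intro norm_sum_additive_character_le[OF q]) auto
      also have "\<dots> \<le> real q / (real H * real g)"
      proof (intro divide_left_mono)
        have "real_of_int (int H * int g) \<le> real_of_int (2 * \<bar>h\<bar>)" using Ui(4)[OF that(2)] by (simp only: of_int_le_iff)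
        then show "real H * real g \<le> 2 * real_of_int \<bar>h\<bar>" by simp
        show "0 < 2 * real_of_int \<bar>h\<bar> * (real H * real g)" using Ui(2)[OF that(2)] H1 g1 by simp
      qed simp
      also have "\<dots> = real r / real H" using g1 by (simp add: qgr)
      finally have "cmod (C h (N d)) \<le> A" using 1 by (simp add: A_def)
      moreover have "cmod (b d * C h (N d)) \<le> 1 * cmod (C h (N d))"
        unfolding norm_mult by (intro mult_right_mono b that) auto
      ultimately show ?thesis by linarith
    qed
    define e\<^sub>U where "e\<^sub>U = 4 * real T * (real H + (real H)\<^sup>2 / sqrt (real r))"
    have eU0: "e\<^sub>U \<ge> 0" by (simp add: e\<^sub>U_def)
    have EU: "real (card {(p, p'). p \<in> U i \<times> U i \<and> p' \<in> U i \<times> U i \<and>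
          [w (fst p) * w (snd p) = w (fst p') * w (snd p')] (mod int q)}) \<le> e\<^sub>U\<^sup>2" (is "real (card ?E) \<le> _")
    proof -
      \<comment> \<open>Modulo r the value \<open>w h\<close> is an inverse of h / g. Weakening the
        congruence to modulus r and inverting it turns it into one between products of the integers
        h / g, which are nonzero and below H in size.\<close>
      define \<delta> where "\<delta> h = h div int g" for h
      have \<delta>: "h = int g * \<delta> h" if "h \<in> U i" for h using Ui(3)[OF that] by (simp add: \<delta>_def)
      define U' where "U' = \<delta> ` U i"
      let ?E' = "{(p, p'). p \<in> U' \<times> U' \<and> p' \<in> U' \<times> U' \<and> [fst p * snd p = fst p' * snd p'] (mod int r)}"
      have \<delta>w: "[w h * \<delta> h = 1] (mod int r)" if "h \<in> U i" for h
      proof -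
        have "h * w h - int g = int g * (w h * \<delta> h - 1)"
          using arg_cong[OF \<delta>[OF that], of "\<lambda>x. x * w h"] by (simp only: right_diff_distrib mult_ac mult_1_right)
        moreover have "int q dvd h * w h - int g" using Ui(6)[OF that] by (simp only: cong_iff_dvd_diff)
        ultimately have "int g * int r dvd int g * (w h * \<delta> h - 1)" by (simp only: qgr of_nat_mult)
        then show ?thesis using g1 by (simp add: cong_iff_dvd_diff)
      qed
      have U'_le: "u \<noteq> 0 \<and> \<bar>u\<bar> \<le> int H" if u: "u \<in> U'" for u
      proof -
        obtain h where h: "h \<in> U i" "u = \<delta> h" using u by (auto simp: U'_def)
        have eq: "h = int g * u" using \<delta>[OF h(1)] unfolding h(2) .
        have "int g * \<bar>u\<bar> < int g * int H"
          using Ui(5)[OF h(1)] by (subst (asm) eq) (simp add: abs_mult mult.commute)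
        then have "\<bar>u\<bar> < int H" using g1 by (simp add: mult_less_cancel_left)
        then show ?thesis using Ui(2)[OF h(1)] eq by auto
      qed
      have finE': "finite ?E'"
        by (rule finite_subset[of _ "(U' \<times> U') \<times> (U' \<times> U')"]) (use finU in \<open>auto simp: U'_def\<close>)
      have "card ?E \<le> card ?E'"
      proof (rule card_inj_on_le[OF _ _ finE'])
        have inj: "h = h'" if "h \<in> U i" "h' \<in> U i" "\<delta> h = \<delta> h'" for h h'
          using \<delta>[OF that(1)] \<delta>[OF that(2)] that(3) by metis
        show "inj_on (\<lambda>((a, b), (c, d)). ((\<delta> a, \<delta> b), (\<delta> c, \<delta> d))) ?E"
          by (rule inj_onI) (clarsimp, blast intro: inj)
        have "((\<delta> a, \<delta> b), (\<delta> c, \<delta> d)) \<in> ?E'" if "((a, b), (c, d)) \<in> ?E" for a b c d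
        proof -
          from that have mem: "a \<in> U i" "b \<in> U i" "c \<in> U i" "d \<in> U i"
            and "[w a * w b = w c * w d] (mod int q)" by auto
          then have cw: "[w a * w b = w c * w d] (mod int r)"
            by (rule_tac cong_dvd_modulus[of _ _ "int q"]) (auto simp: qgr)
          have inv: "[(w x * w y) * (\<delta> x * \<delta> y) = 1] (mod int r)" if "x \<in> U i" "y \<in> U i" for x y
            using cong_mult[OF \<delta>w[OF that(1)] \<delta>w[OF that(2)]] by (simp add: mult_ac)
          have "[1 * (\<delta> a * \<delta> b) = 1 * (\<delta> c * \<delta> d)] (mod int r)"
            unfolding cong_mult_inverse_iff[OF inv[OF mem(1,2)] inv[OF mem(3,4)]]
            using cong_sym[OF cw] by simp
          then show ?thesis using mem by (simp add: U'_def)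
        qed
        then show "(\<lambda>((a, b), (c, d)). ((\<delta> a, \<delta> b), (\<delta> c, \<delta> d))) ` ?E \<subseteq> ?E'" by fast
      qed
      then have "real (card ?E) \<le> real (card ?E')" by simp
      also have "\<dots> \<le> 16 * (real T)\<^sup>2 * (real H ^ 2 + real H ^ 4 / real r)"
      proof (rule card_cong_products_le[OF U'_le r1 H1])
        fix n assume "1 \<le> n" "n \<le> H\<^sup>2"
        moreover have "H \<le> q"
        proof -
          have "1 * r \<le> g * r" using g1 by (rule mult_right_mono) simp
          then show ?thesis using Hr unfolding qgr by linarith
        qed
        then have "H\<^sup>2 \<le> q\<^sup>2" by (intro power_mono) auto
        ultimately show "card {d. d dvd n} \<le> T" by (intro T) linarith+
      qed
      also have "16 * (real T)\<^sup>2 * (real H ^ 2 + real H ^ 4 / real r)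
          = (4 * real T)\<^sup>2 * ((real H)\<^sup>2 + real H ^ 4 / real r)" by (simp add: power_mult_distrib)
      also have "\<dots> \<le> e\<^sub>U\<^sup>2" unfolding e\<^sub>U_def using r1 by (intro add_square_le_square_add_sqrt) auto
      finally show ?thesis .
    qed
    \<comment> \<open>The squared Gauss sum is at most q g, so after division by q^2 it contributes
      g / q = 1 / r.\<close>
    have "(\<Sum>\<chi>\<in>X. (cmod (gauss_sum q \<chi> (int (fst i)) / of_nat q * W i \<chi>))\<^sup>2)
        \<le> (\<Sum>\<chi>\<in>X. 1 / real r * (cmod (W i \<chi>))\<^sup>2)"
    proof (intro sum_mono)
      fix \<chi> assume "\<chi> \<in> X"
      then have "(cmod (gauss_sum q \<chi> (int g)))\<^sup>2 \<le> real q * real g"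
        using X by (intro norm_gauss_sum_dvd_le[OF q _ gq]) auto
      then have "(cmod (gauss_sum q \<chi> (int g)))\<^sup>2 / (real q)\<^sup>2 \<le> real q * real g / (real q)\<^sup>2"
        by (intro divide_right_mono) auto
      also have "\<dots> = 1 / real r" using g1 r1 by (simp add: qgr power2_eq_square)
      finally have "(cmod (gauss_sum q \<chi> (int g)))\<^sup>2 / (real q)\<^sup>2 \<le> 1 / real r" .
      then have "(cmod (gauss_sum q \<chi> (int g)))\<^sup>2 / (real q)\<^sup>2 * (cmod (W i \<chi>))\<^sup>2 \<le> 1 / real r * (cmod (W i \<chi>))\<^sup>2"
        by (intro mult_right_mono) auto
      then show "(cmod (gauss_sum q \<chi> (int (fst i)) / of_nat q * W i \<chi>))\<^sup>2 \<le> 1 / real r * (cmod (W i \<chi>))\<^sup>2"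
        by (simp add: i norm_mult norm_divide power_mult_distrib power_divide)
    qed
    also have "\<dots> = 1 / real r * (\<Sum>\<chi>\<in>X. (cmod (W i \<chi>))\<^sup>2)" by (simp only: sum_distrib_left)
    also have "(\<Sum>\<chi>\<in>X. (cmod (W i \<chi>))\<^sup>2) \<le> real (totient q) * (A\<^sup>2 * (e\<^sub>D * e\<^sub>U))"
      unfolding W_def
      by (rule mean_square_bilinear_le[OF q X D(1) finU D(2) w(1) C_le ED \<open>e\<^sub>D \<ge> 0\<close> EU eU0])
    also have "1 / real r * (real (totient q) * (A\<^sup>2 * (e\<^sub>D * e\<^sub>U)))
        = real (totient q) * (4 * real T * e\<^sub>D * (A\<^sup>2 * (real H + (real H)\<^sup>2 / sqrt (real r)) / real r))"
      by (simp add: e\<^sub>U_def)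
    also have "\<dots> \<le> real (totient q) * (4 * real T * e\<^sub>D * (2 * min (real M) (real q)))"
    proof (intro mult_left_mono)
      have "r \<le> q" using qgr g1 by simp
      then have "A\<^sup>2 * (real H + (real H)\<^sup>2 / sqrt (real r)) \<le> 2 * real r * min (real M) (real q)"
        using M H1 r1 by (intro mult_add_square_div_sqrt_le) (auto simp: A_def)
      then show "A\<^sup>2 * (real H + (real H)\<^sup>2 / sqrt (real r)) / real r \<le> 2 * min (real M) (real q)"
        using r1 by (simp add: divide_le_eq mult_ac)
    qed (use \<open>e\<^sub>D \<ge> 0\<close> in auto)
    finally show ?thesis by (simp add: mult_left_mono divide_right_mono mult_ac)
  qed
  have "(\<Sum>\<chi>\<in>X. (cmod (V \<chi>))\<^sup>2)
      \<le> (\<Sum>\<chi>\<in>X. real (card I) * (\<Sum>i\<in>I. (cmod (gauss_sum q \<chi> (int (fst i)) / of_nat q * W i \<chi>))\<^sup>2))"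
  proof (intro sum_mono)
    fix \<chi> assume "\<chi> \<in> X"
    let ?f = "\<lambda>i. cmod (gauss_sum q \<chi> (int (fst i)) / of_nat q * W i \<chi>)"
    have "cmod (V \<chi>) \<le> (\<Sum>i\<in>I. ?f i)" unfolding V_eq[OF \<open>\<chi> \<in> X\<close>] by (rule norm_sum)
    then have "(cmod (V \<chi>))\<^sup>2 \<le> (\<Sum>i\<in>I. ?f i)\<^sup>2" by (intro power_mono) auto
    also have "\<dots> \<le> (\<Sum>i\<in>I. (?f i)\<^sup>2) * real (card I)" by (rule sum_squared_le_sum_of_squares)
    finally show "(cmod (V \<chi>))\<^sup>2 \<le> real (card I) * (\<Sum>i\<in>I. (?f i)\<^sup>2)" by (simp only: mult.commute)
  qed
  also have "\<dots> = real (card I) * (\<Sum>i\<in>I. \<Sum>\<chi>\<in>X. (cmod (gauss_sum q \<chi> (int (fst i)) / of_nat q * W i \<chi>))\<^sup>2)"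
    by (subst sum.swap) (simp only: sum_distrib_left)
  also have "\<dots> \<le> real (card I) * (\<Sum>i\<in>I. real (totient q) * (8 * real T * min (real M) (real q) * e\<^sub>D))"
    by (intro mult_left_mono sum_mono W_le) auto
  also have "\<dots> = real (totient q) * ((real (card I))\<^sup>2 * (8 * real T * min (real M) (real q) * e\<^sub>D))"
    by (simp add: power2_eq_square)
  finally show ?thesis unfolding X_def V_def cardI .
qed

text \<open>The range M^2 <= q: the bilinear estimate is applied to the m themselves, and the term
  M^2 / sqrt q of their energy is absorbed by M.\<close>

lemma direct_mean_square_le:
  fixes D :: "int set" and b :: "int \<Rightarrow> complex" and N :: "int \<Rightarrow> nat"
  assumes q: "q \<ge> 1" and X: "X \<subseteq> {\<chi>. dirichlet_character q \<chi>}"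
    and D: "finite D" "\<And>d. d \<in> D \<Longrightarrow> coprime d (int q)"
    and b: "\<And>d. d \<in> D \<Longrightarrow> cmod (b d) \<le> 1" and N: "\<And>d. d \<in> D \<Longrightarrow> N d \<le> M"
    and M: "M \<ge> 1" "(real M)\<^sup>2 \<le> real q"
    and T: "\<And>n. 1 \<le> n \<Longrightarrow> n \<le> M\<^sup>2 \<Longrightarrow> card {d. d dvd n} \<le> T"
    and ED: "real (card {(p, p'). p \<in> D \<times> D \<and> p' \<in> D \<times> D \<and>
          [(fst p * snd p)\<^sup>2 = (fst p' * snd p')\<^sup>2] (mod int q)}) \<le> e\<^sub>D\<^sup>2" and "e\<^sub>D \<ge> 0"
  shows "(\<Sum>\<chi>\<in>X. (cmod (\<Sum>d\<in>D. b d * \<chi> (d\<^sup>2) * (\<Sum>n=1..N d. \<chi> (int n))))\<^sup>2)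
    \<le> real (totient q) * (8 * real T * real M * e\<^sub>D)"
proof -
  define U where "U = {m \<in> {1..int M}. coprime m (int q)}"
  have finU: "finite U" unfolding U_def by (rule finite_interval_filter)
  \<comment> \<open>The cutoff m <= N d moves into the coefficient, so that the range
    \<open>U\<close> of m does not depend on d.\<close>
  define c where "c d m = (if m \<le> int (N d) then b d else 0)" for d m
  define e\<^sub>U where "e\<^sub>U = 4 * real T * (real M + (real M)\<^sup>2 / sqrt (real q))"
  have eU0: "e\<^sub>U \<ge> 0" by (simp add: e\<^sub>U_def)
  have "real (card {(p, p'). p \<in> U \<times> U \<and> p' \<in> U \<times> U \<and> [fst p * snd p = fst p' * snd p'] (mod int q)})
      \<le> 16 * (real T)\<^sup>2 * (real M ^ 2 + real M ^ 4 / real q)"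
    using T by (intro card_cong_products_le q M(1)) (auto simp: U_def)
  also have "\<dots> = (4 * real T)\<^sup>2 * ((real M)\<^sup>2 + real M ^ 4 / real q)" by (simp add: power_mult_distrib)
  also have "\<dots> \<le> e\<^sub>U\<^sup>2" unfolding e\<^sub>U_def using q by (intro add_square_le_square_add_sqrt) auto
  finally have EU: "real (card {(p, p'). p \<in> U \<times> U \<and> p' \<in> U \<times> U \<and>
      [fst p * snd p = fst p' * snd p'] (mod int q)}) \<le> e\<^sub>U\<^sup>2" .
  have "(\<Sum>\<chi>\<in>X. (cmod (\<Sum>d\<in>D. b d * \<chi> (d\<^sup>2) * (\<Sum>n=1..N d. \<chi> (int n))))\<^sup>2)
      = (\<Sum>\<chi>\<in>X. (cmod (\<Sum>d\<in>D. \<Sum>m\<in>U. c d m * \<chi> (d\<^sup>2 * m)))\<^sup>2)"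
  proof (intro sum.cong refl arg_cong[where f = "\<lambda>z. (cmod z)\<^sup>2"])
    fix \<chi> d assume "\<chi> \<in> X" and d: "d \<in> D"
    then have \<chi>: "dirichlet_character q \<chi>" using X by auto
    have "(\<Sum>n=1..N d. \<chi> (int n)) = (\<Sum>m\<in>{1..int (N d)}. \<chi> m)"
      by (rule sum.reindex_bij_witness[of _ nat int]) auto
    also have "\<dots> = (\<Sum>m\<in>{m \<in> U. m \<le> int (N d)}. \<chi> m)"
    proof (rule sum.mono_neutral_right)
      show "\<forall>m\<in>{1..int (N d)} - {m \<in> U. m \<le> int (N d)}. \<chi> m = 0"
      proof
        fix m assume m: "m \<in> {1..int (N d)} - {m \<in> U. m \<le> int (N d)}"
        then have "1 \<le> m" "m \<le> int M" using N[OF d] by auto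
        then have "\<not> coprime m (int q)" using m by (auto simp: U_def)
        then show "\<chi> m = 0" by (simp only: dirichlet_character_eq_0_iff[OF \<chi>] simp_thms)
      qed
    qed (auto simp: U_def)
    also have "\<dots> = (\<Sum>m\<in>U. if m \<le> int (N d) then \<chi> m else 0)"
      by (rule sum.inter_filter[OF finU])
    finally have "b d * \<chi> (d\<^sup>2) * (\<Sum>n=1..N d. \<chi> (int n))
        = (\<Sum>m\<in>U. b d * \<chi> (d\<^sup>2) * (if m \<le> int (N d) then \<chi> m else 0))"
      by (simp only: sum_distrib_left)
    also have "\<dots> = (\<Sum>m\<in>U. c d m * \<chi> (d\<^sup>2 * m))"
      by (intro sum.cong refl) (simp add: c_def dirichlet_character_mult[OF \<chi>])
    finally show "b d * \<chi> (d\<^sup>2) * (\<Sum>n=1..N d. \<chi> (int n)) = (\<Sum>m\<in>U. c d m * \<chi> (d\<^sup>2 * m))" .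
  qed
  also have "\<dots> \<le> real (totient q) * (1\<^sup>2 * (e\<^sub>D * e\<^sub>U))"
    using b by (intro mean_square_bilinear_le[OF q X D(1) finU D(2) _ _ ED \<open>e\<^sub>D \<ge> 0\<close> EU eU0])
      (auto simp: U_def c_def)
  also have "e\<^sub>U \<le> 8 * real T * real M"
  proof -
    have "real M \<le> sqrt (real q)" using M(2) by (rule real_le_rsqrt)
    then have "real M * real M \<le> real M * sqrt (real q)" by (intro mult_left_mono) auto
    then have "(real M)\<^sup>2 / sqrt (real q) \<le> real M" using q by (simp add: divide_le_eq power2_eq_square)
    then have "e\<^sub>U \<le> 4 * real T * (real M + real M)" unfolding e\<^sub>U_def by (intro mult_left_mono add_left_mono) auto
    then show ?thesis by simp
  qed
  finally show ?thesis using \<open>e\<^sub>D \<ge> 0\<close> by (simp add: mult_left_mono mult_right_mono mult_ac)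
qed

text \<open>The direct and dual estimates are weakened to a common bound. One divisor bound
  \<open>T\<close> serves both variables and \<tau>(q). The dual box count gives T^2 L^2, the second
  variable T and \<open>e\<^sub>D\<close> a further T^2; 96 is 8 * 12.\<close>

lemma dyadic_mean_square_le:
  fixes D :: "int set" and b :: "int \<Rightarrow> complex" and N :: "int \<Rightarrow> nat"
  assumes q: "q \<ge> 1" and D: "\<And>d. d \<in> D \<Longrightarrow> 1 \<le> d \<and> d \<le> 2 * int K \<and> coprime d (int q)"
    and b: "\<And>d. d \<in> D \<Longrightarrow> cmod (b d) \<le> 1" and N: "\<And>d. d \<in> D \<Longrightarrow> N d \<le> M"
    and M: "M \<ge> 1" and K: "K \<ge> 1" and L: "q < 2 ^ L"
    and Q: "4 * K\<^sup>2 \<le> Q" "M\<^sup>2 \<le> Q" "q\<^sup>2 \<le> Q"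
    and T: "\<And>n. 1 \<le> n \<Longrightarrow> n \<le> Q \<Longrightarrow> card {d. d dvd n} \<le> T"
  shows "(\<Sum>\<chi> | dirichlet_character q \<chi> \<and> \<chi> \<noteq> principal_character q.
      (cmod (\<Sum>d\<in>D. b d * \<chi> (d\<^sup>2) * (\<Sum>n=1..N d. \<chi> (int n))))\<^sup>2)
    \<le> real (totient q) * (96 * real L ^ 2 * real T ^ 5 *
        (min (real M) (real q) * (real K + (real K)\<^sup>2 / sqrt (real q))))"
proof -
  let ?X = "{\<chi>. dirichlet_character q \<chi> \<and> \<chi> \<noteq> principal_character q}"
  let ?\<tau> = "real (card {d. d dvd q})"
  let ?S = "\<Sum>\<chi>\<in>?X. (cmod (\<Sum>d\<in>D. b d * \<chi> (d\<^sup>2) * (\<Sum>n=1..N d. \<chi> (int n))))\<^sup>2"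
  have finD: "finite D" by (rule finite_subset[of _ "{1..2 * int K}"]) (use D in force)+
  have "q \<le> q\<^sup>2" using q by (simp add: power2_eq_square)
  then have "q \<le> Q" using Q(3) by linarith
  then have \<tau>T: "?\<tau> \<le> real T" using T[of q] q by simp
  have "card {d. d dvd q} > 0" using q by (auto simp: card_gt_0_iff intro: exI[of _ 1])
  then have \<tau>1: "?\<tau> \<ge> 1" by simp
  have T1: "real T \<ge> 1" using \<tau>T \<tau>1 by linarith
  have L1: "real L \<ge> 1" using L q by (cases L) auto
  define e\<^sub>D where "e\<^sub>D = 12 * (real T)\<^sup>2 * (real K + (real K)\<^sup>2 / sqrt (real q))"
  have eD0: "e\<^sub>D \<ge> 0" by (simp add: e\<^sub>D_def)
  have ED: "real (card {(p, p'). p \<in> D \<times> D \<and> p' \<in> D \<times> D \<and>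
      [(fst p * snd p)\<^sup>2 = (fst p' * snd p')\<^sup>2] (mod int q)}) \<le> e\<^sub>D\<^sup>2" (is "?E \<le> _")
  proof -
    have "?E \<le> 128 * (real T)\<^sup>2 * ?\<tau> * (real K ^ 2 + real K ^ 4 / real q)"
      using T Q(1) by (intro card_cong_square_products_le D q K) auto
    also have "\<dots> \<le> (12 * (real T)\<^sup>2)\<^sup>2 * ((real K)\<^sup>2 + real K ^ 4 / real q)"
    proof (intro mult_right_mono)
      have "?\<tau> \<le> (real T)\<^sup>2" using mult_mono[OF \<tau>T T1] by (simp add: power2_eq_square)
      then have "128 * (real T)\<^sup>2 * ?\<tau> \<le> 144 * (real T)\<^sup>2 * (real T)\<^sup>2" by (intro mult_mono) auto
      then show "128 * (real T)\<^sup>2 * ?\<tau> \<le> (12 * (real T)\<^sup>2)\<^sup>2" by (simp add: power2_eq_square)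
    qed auto
    also have "\<dots> \<le> e\<^sub>D\<^sup>2" unfolding e\<^sub>D_def using q by (intro add_square_le_square_add_sqrt) auto
    finally show ?thesis .
  qed
  have "?S \<le> real (totient q) * ((real T * real L)\<^sup>2 * (8 * real T * min (real M) (real q) * e\<^sub>D))"
  proof (cases "(real M)\<^sup>2 \<le> real q")
    case True
    have "?S \<le> real (totient q) * (8 * real T * real M * e\<^sub>D)"
      by (rule direct_mean_square_le[where e\<^sub>D = e\<^sub>D])
        (use q finD D b N M True T Q(2) ED eD0 in auto)
    also have "\<dots> = real (totient q) * (1\<^sup>2 * (8 * real T * min (real M) (real q) * e\<^sub>D))"
    proof -
      \<comment> \<open>Here M <= M^2 <= q, so the minimum is M.\<close>
      have "real M * 1 \<le> real M * real M" using M by (intro mult_left_mono) auto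
      then have "min (real M) (real q) = real M" using True by (simp add: power2_eq_square)
      then show ?thesis by simp
    qed
    also have "\<dots> \<le> real (totient q) * ((real T * real L)\<^sup>2 * (8 * real T * min (real M) (real q) * e\<^sub>D))"
    proof (intro mult_left_mono mult_right_mono power_mono)
      show "1 \<le> real T * real L" using mult_mono[OF T1 L1] by simp
    qed (use eD0 in auto)
    finally show ?thesis .
  next
    case False
    have "?S \<le> real (totient q) * ((?\<tau> * real L)\<^sup>2 * (8 * real T * min (real M) (real q) * e\<^sub>D))"
      by (rule dual_mean_square_le)
        (use q finD D b N M False T Q(3) ED eD0 L in auto)
    also have "\<dots> \<le> real (totient q) * ((real T * real L)\<^sup>2 * (8 * real T * min (real M) (real q) * e\<^sub>D))"
      using \<tau>T eD0 by (intro mult_left_mono mult_right_mono power_mono) auto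
    finally show ?thesis .
  qed
  also have "\<dots> = real (totient q) * (96 * real L ^ 2 * real T ^ 5 *
        (min (real M) (real q) * (real K + (real K)\<^sup>2 / sqrt (real q))))"
    by (simp add: e\<^sub>D_def power_mult_distrib power_numeral_reduce)
  finally show ?thesis .
qed

section \<open>Assembly of the dyadic blocks\<close>

lemma abs_moebius_mu_le: "\<bar>moebius_mu n\<bar> \<le> 1"
  by (simp add: moebius_mu_def power_abs)

text \<open>Squaring the first term gives (min K^2) min: one minimum is bounded by M, using M K^2 <=
  x, and the other by q. In the second term the minimum is bounded by M.\<close>

lemma min_mult_add_square_div_sqrt_le:
  fixes K M q x :: real
  assumes "K \<ge> 1" "M \<ge> 0" "q \<ge> 1" "M * K\<^sup>2 \<le> x"
  shows "min M q * (K + K\<^sup>2 / sqrt q) \<le> sqrt x * sqrt q + x / sqrt q"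
proof -
  have m: "0 \<le> min M q" "min M q \<le> M" "min M q \<le> q" using assms by auto
  have "(min M q * K)\<^sup>2 = (min M q * K\<^sup>2) * min M q" by (simp add: power2_eq_square)
  also have "\<dots> \<le> x * q"
  proof (rule mult_mono)
    show "min M q * K\<^sup>2 \<le> x"
      by (rule order_trans[OF mult_right_mono[OF m(2) zero_le_power2] assms(4)])
    have "0 \<le> M * K\<^sup>2" using assms by simp
    then show "0 \<le> x" using assms by linarith
  qed (use m in auto)
  finally have "min M q * K \<le> sqrt (x * q)" by (rule real_le_rsqrt)
  moreover have "min M q * (K\<^sup>2 / sqrt q) \<le> x / sqrt q"
  proof -
    have "min M q * K\<^sup>2 \<le> x"
      by (rule order_trans[OF mult_right_mono[OF m(2) zero_le_power2] assms(4)])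
    then have "(min M q * K\<^sup>2) / sqrt q \<le> x / sqrt q" using assms by (intro divide_right_mono) auto
    then show ?thesis by simp
  qed
  ultimately show ?thesis by (simp add: distrib_left real_sqrt_mult)
qed

text \<open>The Moebius identity, split into L blocks of d. To the L^2 of a single block,
  Cauchy--Schwarz over the blocks adds one factor L and their summation another.\<close>

lemma squarefree_mean_square_le:
  assumes q: "q \<ge> 1" "q \<le> N" and L: "N < 2 ^ L"
    and T: "\<And>n. 1 \<le> n \<Longrightarrow> n \<le> 4 * N\<^sup>2 \<Longrightarrow> card {d. d dvd n} \<le> T"
  shows "(\<Sum>\<chi> | dirichlet_character q \<chi> \<and> \<chi> \<noteq> principal_character q.
      (cmod (\<Sum>n=1..N. of_int \<bar>moebius_mu n\<bar> * \<chi> (int n)))\<^sup>2)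
    \<le> real (totient q) * (96 * real L ^ 4 * real T ^ 5 *
        (sqrt (real N) * sqrt (real q) + real N / sqrt (real q)))"
proof -
  define X where "X = {\<chi>. dirichlet_character q \<chi> \<and> \<chi> \<noteq> principal_character q}"
  \<comment> \<open>If d is not coprime to q then \<chi>(d^2) = 0, so such d drop out.\<close>
  define D where "D = {d. 1 \<le> d \<and> d\<^sup>2 \<le> int N \<and> coprime d (int q)}"
  have D_le: "d \<le> int N" if "d \<in> D" for d
  proof -
    have "d * 1 \<le> d * d" using that by (intro mult_left_mono) (auto simp: D_def)
    moreover have "d * d \<le> int N" using that by (simp add: D_def power2_eq_square)
    ultimately show ?thesis by linarith
  qed
  have finD: "finite D" by (rule finite_subset[of _ "{1..int N}"]) (use D_le in \<open>auto simp: D_def\<close>)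
  have "\<forall>d::int. d \<ge> 1 \<longrightarrow> (\<exists>k. 2 ^ k \<le> d \<and> d < 2 ^ (k + 1))"
  proof (intro allI impI)
    fix d :: int assume "d \<ge> 1"
    then obtain k where "2 ^ k \<le> \<bar>d\<bar>" "\<bar>d\<bar> < 2 ^ (k + 1)" using ex_dyadic_interval[of d] by auto
    then have "2 ^ k \<le> d \<and> d < 2 ^ (k + 1)" using \<open>d \<ge> 1\<close> by simp
    then show "\<exists>k. 2 ^ k \<le> d \<and> d < 2 ^ (k + 1)" by blast
  qed
  then obtain \<kappa> where \<kappa>: "\<And>d::int. d \<ge> 1 \<Longrightarrow> 2 ^ \<kappa> d \<le> d" "\<And>d::int. d \<ge> 1 \<Longrightarrow> d < 2 ^ (\<kappa> d + 1)"
    by metis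
  define Dj where "Dj j = {d \<in> D. \<kappa> d = j}" for j
  define b where "b d = (of_int (moebius_mu (nat d)) :: complex)" for d
  define n where "n d = N div (nat d)\<^sup>2" for d
  define V where "V j \<chi> = (\<Sum>d\<in>Dj j. b d * \<chi> (d\<^sup>2) * (\<Sum>m=1..n d. \<chi> (int m)))" for j and \<chi> :: "int \<Rightarrow> complex"
  have \<kappa>L: "\<kappa> d < L" if "d \<in> D" for d
  proof -
    have "2 ^ \<kappa> d \<le> d" using \<kappa>(1) that by (simp add: D_def)
    also have "d \<le> int N" by (rule D_le[OF that])
    also have "int N < int (2 ^ L)" using L by (simp only: of_nat_less_iff)
    finally show ?thesis by simp
  qed
  have decomp: "(\<Sum>n=1..N. of_int \<bar>moebius_mu n\<bar> * \<chi> (int n)) = (\<Sum>j<L. V j \<chi>)" if "\<chi> \<in> X" for \<chi>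
  proof -
    have \<chi>: "dirichlet_character q \<chi>" using that by (simp add: X_def)
    have "(\<Sum>n=1..N. of_int \<bar>moebius_mu n\<bar> * \<chi> (int n))
        = (\<Sum>d | 1 \<le> d \<and> d\<^sup>2 \<le> N. of_int (moebius_mu d) * (\<Sum>m=1..N div d\<^sup>2. \<chi> (int (d\<^sup>2 * m))))"
      by (rule sum_abs_moebius_eq)
    also have "\<dots> = (\<Sum>d | 1 \<le> d \<and> d\<^sup>2 \<le> int N. b d * \<chi> (d\<^sup>2) * (\<Sum>m=1..n d. \<chi> (int m)))"
    proof (rule sum.reindex_bij_witness[of _ nat int])
      fix d assume d: "d \<in> {d. 1 \<le> d \<and> d\<^sup>2 \<le> int N}"
      then have "int ((nat d)\<^sup>2) \<le> int N" by simp
      then have "(nat d)\<^sup>2 \<le> N" by (simp only: of_nat_le_iff)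
      then show "nat d \<in> {d. 1 \<le> d \<and> d\<^sup>2 \<le> N}" using d by auto
    next
      fix d assume "d \<in> {d. 1 \<le> d \<and> d\<^sup>2 \<le> N}"
      then show "int d \<in> {d. 1 \<le> d \<and> d\<^sup>2 \<le> int N}"
        by (simp flip: of_nat_power)
    next
      fix d :: nat
      show "b (int d) * \<chi> ((int d)\<^sup>2) * (\<Sum>m=1..n (int d). \<chi> (int m))
          = of_int (moebius_mu d) * (\<Sum>m=1..N div d\<^sup>2. \<chi> (int (d\<^sup>2 * m)))"
        by (simp add: b_def n_def dirichlet_character_mult[OF \<chi>] sum_distrib_left mult.assoc)
    qed auto
    also have "\<dots> = (\<Sum>d\<in>D. b d * \<chi> (d\<^sup>2) * (\<Sum>m=1..n d. \<chi> (int m)))"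
    proof (rule sum.mono_neutral_right)
      show "finite {d. 1 \<le> d \<and> d\<^sup>2 \<le> int N}"
      proof (rule finite_subset[of _ "{1..int N}"])
        have "d \<le> int N" if "1 \<le> d" "d\<^sup>2 \<le> int N" for d
        proof -
          have "d * 1 \<le> d * d" using that by (intro mult_left_mono) auto
          moreover have "d * d \<le> int N" using that by (simp add: power2_eq_square)
          ultimately show ?thesis by linarith
        qed
        then show "{d. 1 \<le> d \<and> d\<^sup>2 \<le> int N} \<subseteq> {1..int N}" by auto
      qed simp
      show "\<forall>d\<in>{d. 1 \<le> d \<and> d\<^sup>2 \<le> int N} - D. b d * \<chi> (d\<^sup>2) * (\<Sum>m=1..n d. \<chi> (int m)) = 0"
      proof
        fix d assume "d \<in> {d. 1 \<le> d \<and> d\<^sup>2 \<le> int N} - D"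
        then have "\<not> coprime (d\<^sup>2) (int q)" by (simp add: D_def)
        then have "\<chi> (d\<^sup>2) = 0" by (simp only: dirichlet_character_eq_0_iff[OF \<chi>] simp_thms)
        then show "b d * \<chi> (d\<^sup>2) * (\<Sum>m=1..n d. \<chi> (int m)) = 0" by simp
      qed
    qed (auto simp: D_def)
    also have "\<dots> = (\<Sum>j<L. V j \<chi>)"
      unfolding V_def Dj_def using finD \<kappa>L by (intro sum.group[symmetric]) auto
    finally show ?thesis .
  qed
  let ?B = "real (totient q) * (96 * real L ^ 2 * real T ^ 5 *
      (sqrt (real N) * sqrt (real q) + real N / sqrt (real q)))"
  have V_le: "(\<Sum>\<chi>\<in>X. (cmod (V j \<chi>))\<^sup>2) \<le> ?B" for j
  proof (cases "4 ^ j \<le> N")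
    case False
    have "Dj j = {}"
    proof (rule ccontr)
      assume "Dj j \<noteq> {}"
      then obtain d where d: "d \<in> D" "\<kappa> d = j" by (auto simp: Dj_def)
      then have "2 ^ j \<le> d" using \<kappa>(1) by (auto simp: D_def)
      then have "(2 ^ j)\<^sup>2 \<le> d\<^sup>2" by (intro power_mono) auto
      also have "d\<^sup>2 \<le> int N" using d by (simp add: D_def)
      finally have "int (4 ^ j) \<le> int N" by (simp add: power2_eq_square flip: power_mult_distrib)
      then show False using False by (simp only: of_nat_le_iff)
    qed
    then show ?thesis by (simp add: V_def)
  next
    case True
    define K where "K = (2::nat) ^ j"
    \<comment> \<open>For d >= K this bounds the length N div d^2 of every inner sum. It is positive
      because K^2 = 4^j <= N; blocks with 4^j > N are empty.\<close>
    define M where "M = N div K\<^sup>2"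
    have K2: "K\<^sup>2 = 4 ^ j" by (simp add: K_def power2_eq_square flip: power_mult_distrib)
    have K1: "K \<ge> 1" by (simp add: K_def)
    have M1: "M \<ge> 1" using True K1 unfolding M_def K2 by (simp add: div_greater_zero_iff Suc_le_eq)
    have MK: "M * K\<^sup>2 \<le> N" by (simp add: M_def)
    have Dj: "1 \<le> d \<and> d \<le> 2 * int K \<and> coprime d (int q)" "int K \<le> d" if "d \<in> Dj j" for d
      using that \<kappa>[of d] by (auto simp: Dj_def D_def K_def)
    have "(\<Sum>\<chi>\<in>X. (cmod (V j \<chi>))\<^sup>2) \<le> real (totient q) * (96 * real L ^ 2 * real T ^ 5 *
        (min (real M) (real q) * (real K + (real K)\<^sup>2 / sqrt (real q))))"
      unfolding X_def V_def
    \<comment> \<open>The cutoff 4 N^2 covers 4 K^2, M^2 and q^2, by K^2 <= N <= N^2, M <= N and q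
      <= N.\<close>
    proof (rule dyadic_mean_square_le[OF q(1) Dj(1) _ _ M1 K1 _ _ _ _ T])
      show "cmod (b d) \<le> 1" for d
        using abs_moebius_mu_le[of "nat d"] by (simp add: b_def norm_of_int flip: of_int_abs)
      show "n d \<le> M" if "d \<in> Dj j" for d
        unfolding n_def M_def using Dj(2)[OF that] K1 by (intro div_le_mono2 power_mono) auto
      show "q < 2 ^ L" using q L by linarith
      have "N * 1 \<le> N * N" using q by (intro mult_left_mono) auto
      then have NN: "N \<le> N\<^sup>2" by (simp add: power2_eq_square)
      show "4 * K\<^sup>2 \<le> 4 * N\<^sup>2" using True K2 NN by linarith
      have "M \<le> N" by (simp add: M_def)
      then have "M\<^sup>2 \<le> N\<^sup>2" by (intro power_mono) auto
      then show "M\<^sup>2 \<le> 4 * N\<^sup>2" by linarith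
      have "q\<^sup>2 \<le> N\<^sup>2" using q by (intro power_mono) auto
      then show "q\<^sup>2 \<le> 4 * N\<^sup>2" by linarith
    qed
    also have "\<dots> \<le> ?B"
    proof (intro mult_left_mono)
      have "real M * (real K)\<^sup>2 \<le> real N"
        using MK by (metis of_nat_le_iff of_nat_mult of_nat_power)
      then show "min (real M) (real q) * (real K + (real K)\<^sup>2 / sqrt (real q))
          \<le> sqrt (real N) * sqrt (real q) + real N / sqrt (real q)"
        using K1 q by (intro min_mult_add_square_div_sqrt_le) auto
    qed auto
    finally show ?thesis .
  qed
  have "(\<Sum>\<chi>\<in>X. (cmod (\<Sum>n=1..N. of_int \<bar>moebius_mu n\<bar> * \<chi> (int n)))\<^sup>2)
      \<le> (\<Sum>\<chi>\<in>X. real L * (\<Sum>j<L. (cmod (V j \<chi>))\<^sup>2))"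
  proof (intro sum_mono)
    fix \<chi> assume "\<chi> \<in> X"
    have "cmod (\<Sum>j<L. V j \<chi>) \<le> (\<Sum>j<L. cmod (V j \<chi>))" by (rule norm_sum)
    then have "(cmod (\<Sum>j<L. V j \<chi>))\<^sup>2 \<le> (\<Sum>j<L. cmod (V j \<chi>))\<^sup>2" by (intro power_mono) auto
    also have "\<dots> \<le> (\<Sum>j<L. (cmod (V j \<chi>))\<^sup>2) * real (card {..<L})" by (rule sum_squared_le_sum_of_squares)
    finally show "(cmod (\<Sum>n=1..N. of_int \<bar>moebius_mu n\<bar> * \<chi> (int n)))\<^sup>2 \<le> real L * (\<Sum>j<L. (cmod (V j \<chi>))\<^sup>2)"
      unfolding decomp[OF \<open>\<chi> \<in> X\<close>] by (simp add: mult.commute)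
  qed
  also have "\<dots> = real L * (\<Sum>j<L. \<Sum>\<chi>\<in>X. (cmod (V j \<chi>))\<^sup>2)"
    by (subst sum.swap) (simp only: sum_distrib_left)
  also have "\<dots> \<le> real L * (\<Sum>j<L. ?B)"
    by (intro mult_left_mono sum_mono V_le) auto
  also have "\<dots> = real (totient q) * (96 * real L ^ 4 * real T ^ 5 *
        (sqrt (real N) * sqrt (real q) + real N / sqrt (real q)))"
    by (simp add: power_numeral_reduce)
  finally show ?thesis unfolding X_def .
qed

theorem corollary1:
  fixes \<epsilon> :: real
  assumes "\<epsilon> > 0"
  shows "\<exists>C>0. \<forall>(x::real) (q::nat). x \<ge> 1 \<longrightarrow> q \<ge> 1 \<longrightarrow> real q \<le> x \<longrightarrow>
    \<bar>1 / real (totient q) *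
       (\<Sum>\<chi>\<in>{\<chi>. dirichlet_character q \<chi> \<and> \<chi> \<noteq> principal_character q}.
          (cmod (\<Sum>n=1..nat \<lfloor>x\<rfloor>. of_int \<bar>moebius_mu n\<bar> * \<chi> (int n))) ^ 2)\<bar>
    \<le> C * (x powr \<epsilon> * (x powr (1/2) * real q powr (1/2) + x / real q powr (1/2)))"
proof -
  \<comment> \<open>The bound contains \<open>L\<^sup>4 T\<^sup>5\<close>, where up to constants \<open>L \<le> x powr \<delta>\<close> and \<open>T \<le> x powr (2 * \<delta>)\<close>.\<close>
  define \<delta> where "\<delta> = \<epsilon> / 14"
  have \<delta>: "\<delta> > 0" using assms by (simp add: \<delta>_def)
  obtain C where C: "C \<ge> 1" "\<And>n::nat. n > 0 \<Longrightarrow> real (card {d. d dvd n}) \<le> C * real n powr \<delta>"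
    using divisor_bound[OF \<delta>] by blast
  \<comment> \<open>From ln 2 >= 1/2 and ln x <= x powr \<delta> / \<delta> follows log 2 x <= (2 /
    \<delta>) x powr \<delta>; the extra 1 absorbs the rounding in \<open>L\<close>.\<close>
  define C\<^sub>L where "C\<^sub>L = 2 / \<delta> + 1"
  \<comment> \<open>The divisor bound is used for n <= 4 N^2 <= 4 x^2, which gives the 4 powr
    \<delta> and the exponent 2 \<delta>.\<close>
  define C\<^sub>T where "C\<^sub>T = C * 4 powr \<delta>"
  have pos: "C\<^sub>L > 0" "C\<^sub>T > 0" using C(1) \<delta> by (auto simp: C\<^sub>L_def C\<^sub>T_def add_pos_pos)
  show ?thesis
  proof (intro exI[of _ "96 * C\<^sub>L ^ 4 * C\<^sub>T ^ 5"] conjI allI impI)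
    show "0 < 96 * C\<^sub>L ^ 4 * C\<^sub>T ^ 5" using pos by simp
    fix x :: real and q :: nat assume x: "x \<ge> 1" and q: "q \<ge> 1" and qx: "real q \<le> x"
    define N where "N = nat \<lfloor>x\<rfloor>"
    have Nx: "real N \<le> x" using x by (simp add: N_def)
    have qN: "q \<le> N" using qx by (simp add: N_def le_nat_floor)
    define L where "L = nat \<lfloor>log 2 x\<rfloor> + 1"
    have log0: "log 2 x \<ge> 0" using x by simp
    have "log 2 x < real L" unfolding L_def using log0 by linarith
    then have "x < 2 powr real L" using x by (simp add: log_less_iff)
    then have "x < 2 ^ L" by (simp add: powr_realpow)
    then have "real N < 2 ^ L" using Nx by linarith
    then have "real N < real (2 ^ L)" by (simp only: of_nat_power of_nat_numeral)
    then have L: "N < 2 ^ L" by (simp only: of_nat_less_iff)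
    have L_le: "real L \<le> C\<^sub>L * x powr \<delta>"
    proof -
      have "1 / 2 \<le> ln (2::real)"
        using ln_one_minus_pos_upper_bound[of "1/2"] by (simp add: ln_div)
      then have "ln x / ln 2 \<le> ln x / (1 / 2)" using x by (intro divide_left_mono) auto
      moreover have "ln x \<le> x powr \<delta> / \<delta>" by (rule ln_powr_bound[OF x \<delta>])
      ultimately have "log 2 x \<le> 2 / \<delta> * x powr \<delta>" by (simp add: log_def)
      moreover have "1 \<le> x powr \<delta>" using x \<delta> by (simp add: ge_one_powr_ge_zero)
      moreover have "real L \<le> log 2 x + 1" unfolding L_def using log0 by linarith
      ultimately show ?thesis by (simp add: C\<^sub>L_def distrib_right)
    qed
    \<comment> \<open>Rounding down is harmless, because an integer below a real number is below its
      floor.\<close>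
    define T where "T = nat \<lfloor>C\<^sub>T * x powr (2 * \<delta>)\<rfloor>"
    have T_le: "real T \<le> C\<^sub>T * x powr (2 * \<delta>)" using pos x by (simp add: T_def)
    have T: "card {d. d dvd n} \<le> T" if n: "1 \<le> n" "n \<le> 4 * N\<^sup>2" for n
    proof -
      have "real n \<le> real (4 * N\<^sup>2)" using n(2) by (simp only: of_nat_le_iff)
      also have "\<dots> = 4 * (real N)\<^sup>2" by simp
      also have "\<dots> \<le> 4 * x\<^sup>2" using Nx by (intro mult_left_mono power_mono) auto
      finally have "real n \<le> 4 * x\<^sup>2" .
      then have "real n powr \<delta> \<le> (4 * x\<^sup>2) powr \<delta>" using \<delta> by (intro powr_mono2) auto
      also have "\<dots> = 4 powr \<delta> * x powr (2 * \<delta>)"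
        using x by (simp add: powr_mult powr_powr flip: powr_numeral)
      finally have "real (card {d. d dvd n}) \<le> C * (4 powr \<delta> * x powr (2 * \<delta>))"
        using C n(1) by (intro order_trans[OF C(2)] mult_left_mono) auto
      then show ?thesis by (simp add: T_def C\<^sub>T_def le_nat_floor mult.assoc)
    qed
    let ?S = "\<Sum>\<chi>\<in>{\<chi>. dirichlet_character q \<chi> \<and> \<chi> \<noteq> principal_character q}.
        (cmod (\<Sum>n=1..N. of_int \<bar>moebius_mu n\<bar> * \<chi> (int n))) ^ 2"
    have S0: "?S \<ge> 0" by (intro sum_nonneg) auto
    have "?S \<le> real (totient q) * (96 * real L ^ 4 * real T ^ 5 *
        (sqrt (real N) * sqrt (real q) + real N / sqrt (real q)))"
      by (rule squarefree_mean_square_le[OF q qN L T])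
    then have "1 / real (totient q) * ?S \<le> 96 * real L ^ 4 * real T ^ 5 *
        (sqrt (real N) * sqrt (real q) + real N / sqrt (real q))"
      using q by (simp add: divide_le_eq mult.commute)
    also have "\<dots> \<le> 96 * (C\<^sub>L * x powr \<delta>) ^ 4 * (C\<^sub>T * x powr (2 * \<delta>)) ^ 5 *
        (sqrt x * sqrt (real q) + x / sqrt (real q))"
      using L_le T_le Nx pos x
      by (intro mult_mono add_mono divide_right_mono mult_right_mono power_mono) auto
    also have "\<dots> = 96 * C\<^sub>L ^ 4 * C\<^sub>T ^ 5 * (((x powr \<delta>) ^ 4 * (x powr (2 * \<delta>)) ^ 5) *
        (sqrt x * sqrt (real q) + x / sqrt (real q)))"
      by (simp only: power_mult_distrib mult_ac)
    \<comment> \<open>The exponents add up to 4 \<delta> + 10 \<delta> = 14 \<delta> =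
      \<epsilon>.\<close>
    also have "(x powr \<delta>) ^ 4 * (x powr (2 * \<delta>)) ^ 5 = x powr \<epsilon>"
      using x by (simp add: powr_powr \<delta>_def flip: powr_realpow powr_add)
    finally show "\<bar>1 / real (totient q) *
       (\<Sum>\<chi>\<in>{\<chi>. dirichlet_character q \<chi> \<and> \<chi> \<noteq> principal_character q}.
          (cmod (\<Sum>n=1..nat \<lfloor>x\<rfloor>. of_int \<bar>moebius_mu n\<bar> * \<chi> (int n))) ^ 2)\<bar>
      \<le> 96 * C\<^sub>L ^ 4 * C\<^sub>T ^ 5 * (x powr \<epsilon> * (x powr (1/2) * real q powr (1/2) + x / real q powr (1/2)))"
      using S0 x by (simp add: powr_half_sqrt N_def)
  qed
qed

end
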